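(* Let $J\subset F=\{1,\dots,k\}$ with $k_J=|J|$, and consider the candidate model $Y\sim\mathcal N_{n\times p}(A_JB_J,\Sigma\otimes I_n)$ with the notation $P_J,D_J,\Theta_J=P_J^\top B_J,X_J,S_J$ of the context. Let $\Lambda_J=\mathrm{diag}(\lambda_{J,1},\dots,\lambda_{J,k_J})$ and $C_J=\mathrm{diag}(c_{J,1},\dots,c_{J,k_J})$ be diagonal matrices with $\lambda_{J,i}>0$ and $c_{J,i}>0$ for $i=1,\dots,k_J$. Consider the prior $$\Theta_J\mid\Sigma\ \sim\ \mathcal N_{k_J\times p}\bigl(0,\ \Sigma\otimes D_J(\Lambda_J^{-1}C_J-I_{k_J})\bigr),\qquad \Sigma\sim\pi(\Sigma),$$ where $\pi(\Sigma)$ is any distribution on the positive definite matrices such that $E[\Sigma^{-1}\mid X_J,S_J]$ and $E[\Sigma^{-1}\mid X_J,S_J]^{-1}$ exist. Then the Bayes estimator of $B_J$ based on this prior (under the squared risk) is $$\hat B_{J,\mathrm B}=P_J\hat\Theta_{J,\mathrm B}=P_J\,(I_{k_J}-\Lambda_JC_J^{-1})\,D_J\,P_J^\top A_J^\top Y,$$ where $\hat\Theta_{J,\mathrm B}$ is the Bayes estimator of $\Theta_J$, and $\hat B_{J,\mathrm B}$ is a generalized ridge estimator, i.e. it can be written as $(A_J^\top A_J+P_JK_JP_J^\top)^{-1}A_J^\top Y$ with a $k_J\times k_J$ diagonal matrix $K_J$.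
   Context: $\mathcal N_{m\times q}(M,\Sigma\otimes\Psi)$ denotes the matrix normal distribution on $m\times q$ matrices with mean $M$, row covariance $\Psi$ ($m\times m$) and column covariance $\Sigma$ ($q\times q$), i.e. with density proportional to $\exp\{-\tfrac12\mathrm{tr}[\Sigma^{-1}(X-M)^\top\Psi^{-1}(X-M)]\}$. $Y$ is an $n\times p$ random matrix; $A$ is an $n\times k$ matrix of explanatory variables with $\mathrm{rank}(A)=k$; $n-p-k-1>0$; $\Sigma$ is an unknown $p\times p$ covariance matrix. For $J\subset F$, $A_J$ is the $n\times k_J$ matrix of the columns of $A$ indexed by $J$, and $B_J$ is an unknown $k_J\times p$ matrix. $P_J$ is the $k_J\times k_J$ orthogonal matrix of eigenvectors of $(A_J^\top A_J)^{-1}$: $P_J^\top(A_J^\top A_J)^{-1}P_J=D_J=\mathrm{diag}(d_{J,1},\dots,d_{J,k_J})$ with $d_{J,1}\ge\cdots\ge d_{J,k_J}$. Set $\Theta_J=P_J^\top B_J$, $X_J=D_JP_J^\top A_J^\top Y$ ($k_J\times p$) and $S_J=Y^\top\bigl(I_n-A_J(A_J^\top A_J)^{-1}A_J^\top\bigr)Y$. The squared risk of an estimator $\Phi$ of $B_J$ is the expectation of the loss $\mathrm{tr}\bigl(\Sigma^{-1}(B_J-\Phi)^\top A_J^\top A_J(B_J-\Phi)\bigr)$; in terms of $\Theta_J$ the loss of an estimator $\Phi_J$ of $\Theta_J$ is $\mathrm{tr}(\Sigma^{-1}(\Phi_J-\Theta_J)^\top D_J^{-1}(\Phi_J-\Theta_J))$.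 The Bayes estimator is the function of the data minimizing the posterior expected loss. *)

theory Defs
  imports
    "HOL-Probability.Probability"
    "Jordan_Normal_Form.DL_Submatrix"
    "Jordan_Normal_Form.DL_Rank"
    "Jordan_Normal_Form.Gauss_Jordan_Elimination"
begin

definition mat_trace :: "real mat \<Rightarrow> real" where
  "mat_trace A = (\<Sum>i<dim_row A. A $$ (i, i))"

text \<open>The inverse as a total function; on singular matrices the value is the (meaningless) zero matrix.\<close>
definition mat_inv :: "real mat \<Rightarrow> real mat" where
  "mat_inv A = (case mat_inverse A of Some B \<Rightarrow> B | None \<Rightarrow> 0\<^sub>m (dim_row A) (dim_col A))"

definition pos_def_mat :: "nat \<Rightarrow> real mat \<Rightarrow> bool" where
  "pos_def_mat p S \<longleftrightarrow> S \<in> carrier_mat p p \<and> transpose_mat S = S \<and>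
     (\<forall>v \<in> carrier_vec p. v \<noteq> 0\<^sub>v p \<longrightarrow> scalar_prod v (S *\<^sub>v v) > 0)"

text \<open>Lebesgue measure on the Borel sets of the space of real matrices with \<open>m\<close> rows and
  \<open>q\<close> columns. Its sigma-algebra also serves as the Borel algebra for random matrices.
  The dimensions may be zero, in which case this is the point mass at the only such matrix.\<close>
definition mat_lebesgue :: "nat \<Rightarrow> nat \<Rightarrow> real mat measure" where
  "mat_lebesgue m q =
     embed_measure (\<Pi>\<^sub>M ij \<in> {0..<m} \<times> {0..<q}. lborel) (Matrix.mat m q)"

lemma space_mat_lebesgue: "space (mat_lebesgue m q) = carrier_mat m q"
proof (intro equalityI subsetI)
  fix X assume "X \<in> space (mat_lebesgue m q)"
  then show "X \<in> carrier_mat m q"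
    by (auto simp: mat_lebesgue_def space_embed_measure)
next
  fix X :: "real mat" assume X: "X \<in> carrier_mat m q"
  let ?f = "restrict (\<lambda>ij. X $$ ij) ({0..<m} \<times> {0..<q})"
  have "X = Matrix.mat m q ?f"
    using X by (intro eq_matI) auto
  moreover have "?f \<in> space (\<Pi>\<^sub>M ij \<in> {0..<m} \<times> {0..<q}. (lborel :: real measure))"
    by (simp add: space_PiM)
  ultimately show "X \<in> space (mat_lebesgue m q)"
    unfolding mat_lebesgue_def space_embed_measure by blast
qed

text \<open>The matrix normal distribution with mean \<open>Mu\<close>, row covariance \<open>Psi\<close> (of size \<open>m\<close>) and
  column covariance \<open>Sig\<close> (of size \<open>q\<close>); both covariances are meant to be positive definite.\<close>
definition matrix_normal_density ::
    "nat \<Rightarrow> nat \<Rightarrow> real mat \<Rightarrow> real mat \<Rightarrow> real mat \<Rightarrow> real mat \<Rightarrow> real" where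
  "matrix_normal_density m q Mu Sig Psi X =
     (2 * pi) powr (- (real m * real q) / 2)
       * Determinant.det Sig powr (- real m / 2) * Determinant.det Psi powr (- real q / 2)
       * exp (- (1 / 2) *
           mat_trace (mat_inv Sig * transpose_mat (X - Mu) * mat_inv Psi * (X - Mu)))"

definition matrix_normal ::
    "nat \<Rightarrow> nat \<Rightarrow> real mat \<Rightarrow> real mat \<Rightarrow> real mat \<Rightarrow> real mat measure" where
  "matrix_normal m q Mu Sig Psi =
     density (mat_lebesgue m q) (\<lambda>X. ennreal (matrix_normal_density m q Mu Sig Psi X))"

text \<open>\<open>K z\<close> is the conditional distribution of \<open>X\<close> given \<open>Z = z\<close>.\<close>
definition has_cond_distr ::
    "'w measure \<Rightarrow> 'a measure \<Rightarrow> ('w \<Rightarrow> 'a) \<Rightarrow> 'b measure \<Rightarrow> ('w \<Rightarrow> 'b) \<Rightarrow> ('b \<Rightarrow> 'a measure) \<Rightarrow> bool"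
  where
  "has_cond_distr M MX X MZ Z K \<longleftrightarrow> X \<in> M \<rightarrow>\<^sub>M MX \<and> Z \<in> M \<rightarrow>\<^sub>M MZ \<and>
     (\<forall>A \<in> sets MX. \<forall>B \<in> sets MZ.
        emeasure M {\<omega> \<in> space M. X \<omega> \<in> A \<and> Z \<omega> \<in> B}
          = (\<integral>\<^sup>+ \<omega>. emeasure (K (Z \<omega>)) A * indicator B (Z \<omega>) \<partial>M))"

abbreviation generated_algebra :: "'w measure \<Rightarrow> 'd measure \<Rightarrow> ('w \<Rightarrow> 'd) \<Rightarrow> 'w measure" where
  "generated_algebra M N T \<equiv> vimage_algebra (space M) T N"

text \<open>Entrywise conditional expectation of a random \<open>m\<close> by \<open>q\<close> matrix. The expectation need only
  be finite conditionally, so no integrability over the whole of \<open>M\<close> is asked for.\<close>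
definition cond_exp_mat_exists ::
    "'w measure \<Rightarrow> 'w measure \<Rightarrow> nat \<Rightarrow> nat \<Rightarrow> ('w \<Rightarrow> real mat) \<Rightarrow> bool" where
  "cond_exp_mat_exists M F m q X \<longleftrightarrow>
     (\<forall>i<m. \<forall>j<q. AE \<omega> in M. nn_cond_exp M F (\<lambda>\<omega>. ennreal \<bar>X \<omega> $$ (i, j)\<bar>) \<omega> < \<infinity>)"

definition cond_exp_mat ::
    "'w measure \<Rightarrow> 'w measure \<Rightarrow> nat \<Rightarrow> nat \<Rightarrow> ('w \<Rightarrow> real mat) \<Rightarrow> 'w \<Rightarrow> real mat" where
  "cond_exp_mat M F m q X \<omega> =
     Matrix.mat m q (\<lambda>(i, j). real_cond_exp M F (\<lambda>\<omega>. X \<omega> $$ (i, j)) \<omega>)"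

text \<open>The parameters live on the same probability space as the data \<open>T\<close>, so a loss depends on the
  sample point \<open>\<omega>\<close> (through the parameters) and on the action taken. Losses are nonnegative,
  and the posterior expected loss may be infinite.\<close>
definition posterior_expected_loss ::
    "'w measure \<Rightarrow> 'd measure \<Rightarrow> ('w \<Rightarrow> 'd) \<Rightarrow> ('w \<Rightarrow> 'a \<Rightarrow> real) \<Rightarrow> ('d \<Rightarrow> 'a) \<Rightarrow> 'w \<Rightarrow> ennreal" where
  "posterior_expected_loss M N T L \<Phi> =
     nn_cond_exp M (generated_algebra M N T) (\<lambda>\<omega>. ennreal (L \<omega> (\<Phi> (T \<omega>))))"

definition is_bayes_estimator ::
    "'w measure \<Rightarrow> 'd measure \<Rightarrow> ('w \<Rightarrow> 'd) \<Rightarrow> 'a measure \<Rightarrow> ('w \<Rightarrow> 'a \<Rightarrow> real) \<Rightarrow> ('d \<Rightarrow> 'a) \<Rightarrow> bool"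
  where
  "is_bayes_estimator M N T E L \<Phi> \<longleftrightarrow> \<Phi> \<in> N \<rightarrow>\<^sub>M E \<and>
     (\<forall>\<Phi>' \<in> N \<rightarrow>\<^sub>M E. AE \<omega> in M.
        posterior_expected_loss M N T L \<Phi> \<omega> \<le> posterior_expected_loss M N T L \<Phi>' \<omega>)"

text \<open>Uniqueness can only be meant up to null sets of the data.\<close>
definition is_the_bayes_estimator ::
    "'w measure \<Rightarrow> 'd measure \<Rightarrow> ('w \<Rightarrow> 'd) \<Rightarrow> 'a measure \<Rightarrow> ('w \<Rightarrow> 'a \<Rightarrow> real) \<Rightarrow> ('d \<Rightarrow> 'a) \<Rightarrow> bool"
  where
  "is_the_bayes_estimator M N T E L \<Phi> \<longleftrightarrow> is_bayes_estimator M N T E L \<Phi> \<and>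
     (\<forall>\<Phi>'. is_bayes_estimator M N T E L \<Phi>' \<longrightarrow> (AE \<omega> in M. \<Phi>' (T \<omega>) = \<Phi> (T \<omega>)))"

definition quadratic_loss :: "real mat \<Rightarrow> real mat \<Rightarrow> real mat \<Rightarrow> real mat \<Rightarrow> real" where
  "quadratic_loss W Sig Par \<Phi> =
     mat_trace (mat_inv Sig * transpose_mat (Par - \<Phi>) * W * (Par - \<Phi>))"

text \<open>\<open>G\<close> maps the observation to an estimate; the ridge matrix \<open>K\<close> may not depend on it.\<close>
definition is_generalized_ridge ::
    "nat \<Rightarrow> nat \<Rightarrow> nat \<Rightarrow> real mat \<Rightarrow> real mat \<Rightarrow> (real mat \<Rightarrow> real mat) \<Rightarrow> bool" where
  "is_generalized_ridge n p k A P G \<longleftrightarrow>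
     (\<exists>K \<in> carrier_mat k k. diagonal_mat K \<and>
        invertible_mat (transpose_mat A * A + P * K * transpose_mat P) \<and>
        (\<forall>y \<in> carrier_mat n p.
           G y = mat_inv (transpose_mat A * A + P * K * transpose_mat P) * transpose_mat A * y))"

end

theory Submission
  imports Defs
begin

text \<open>Given \<open>(Y, \<Sigma>)\<close>, the posterior of \<open>\<Theta>\<close> is Gaussian with a mean \<open>m(Y)\<close> that does not depend
  on \<open>\<Sigma>\<close>. Only its symmetry is used: the law of \<open>(Y, \<Theta>, \<Sigma>)\<close> is invariant under
  \<open>\<Theta> \<mapsto> 2 m(Y) - \<Theta>\<close>. By the parallelogram law the posterior loss of any estimator \<open>\<Phi>\<close> is then
  the posterior loss of \<open>m\<close> plus the conditional expectation of the nonnegative form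
  \<open>tr(\<Sigma>\<^sup>-\<^sup>1 (m - \<Phi>)\<^sup>T W (m - \<Phi>))\<close>, so \<open>m\<close> is optimal, whichever part of \<open>Y\<close> is observed.
  The risk of \<open>m\<close> is at most that of the zero estimator, which is finite uniformly in \<open>\<Sigma>\<close>;
  hence an optimal \<open>\<Phi>\<close> has zero excess and equals \<open>m\<close> almost surely.\<close>

section \<open>Integration over spaces of matrices\<close>

text \<open>The law of Sigma is arbitrary, so an explicit posterior would need a disintegration with
  normalising constants that depend on the data. Integrals over the events {T in A} avoid both: they
  determine conditional expectations, and the law of Sigma enters them only as an outer integration.

  The centre m is free of Sigma because prior and likelihood share the column covariance: the joint
  exponent is -1/2 tr(Sigma^-1 Q(x)) with a matrix-valued quadratic Q that does not involve Sigma,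
  and the square is completed in Q before the trace is taken. With Z = A_J P_J, the centre solves
  (G^-1 + Z^T Z) m = Z^T y. In the basis P_J both G and Z^T Z = D_J^-1 are diagonal, so this is one
  scalar equation per row, with solution m = (I - Lambda C^-1) D Z^T y.

  Hence optimality is expressed by adding an excess, and uniqueness by cancelling one risk, which
  must therefore be finite.\<close>

lemma nn_integral_PiM_lborel_affine:
  fixes c :: real and a :: "'i \<Rightarrow> real"
  assumes I: "finite I" and c: "c \<noteq> 0"
    and f: "f \<in> borel_measurable (\<Pi>\<^sub>M i\<in>I. lborel)"
  shows "(\<integral>\<^sup>+x. f x \<partial>(\<Pi>\<^sub>M i\<in>I. lborel))
    = ennreal (\<bar>c\<bar> ^ card I) * (\<integral>\<^sup>+x. f (\<lambda>i\<in>I. a i + c * x i) \<partial>(\<Pi>\<^sub>M i\<in>I. lborel))"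
proof -
  interpret product_sigma_finite "\<lambda>_. lborel :: real measure"
    by standard
  let ?L = "\<Pi>\<^sub>M i\<in>I. (lborel :: real measure)"
  let ?T = "\<lambda>x. \<lambda>i\<in>I. a i + c * x i"
  have T[measurable]: "?T \<in> ?L \<rightarrow>\<^sub>M ?L"
    by (intro measurable_restrict) measurable
  \<comment> \<open>A product measure is determined by its values on boxes, and on a box each
    coordinate contributes one factor \<bar>c\<bar> from the one-dimensional affine rule.\<close>
  have "density (distr ?L ?L ?T) (\<lambda>_. ennreal (\<bar>c\<bar> ^ card I)) = ?L"
  proof (rule PiM_eqI[OF I])
    fix A :: "'i \<Rightarrow> real set" assume "\<And>i. i \<in> I \<Longrightarrow> A i \<in> sets lborel"
    then have A[measurable]: "\<And>i. i \<in> I \<Longrightarrow> A i \<in> sets borel" by simp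
    let ?B = "\<lambda>i. (\<lambda>x. a i + c * x) -` A i"
    have B[measurable]: "?B i \<in> sets borel" if "i \<in> I" for i
      using measurable_sets[of "\<lambda>x. a i + c * x" borel borel "A i"] A[OF that] by simp
    have box: "Pi\<^sub>E I A \<in> sets ?L"
      using A I by (intro sets_PiM_I_finite) auto
    have "emeasure lborel (A i) = ennreal \<bar>c\<bar> * emeasure lborel (?B i)" if "i \<in> I" for i
    proof -
      have "emeasure lborel (A i)
          = emeasure (density (distr lborel borel (\<lambda>x. a i + c * x)) (\<lambda>_. ennreal \<bar>c\<bar>)) (A i)"
        by (subst lborel_real_affine[OF c, of "a i"]) simp
      also have "\<dots> = ennreal \<bar>c\<bar> * emeasure (distr lborel borel (\<lambda>x. a i + c * x)) (A i)"
        using A[OF that] by (subst emeasure_density_const) auto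
      also have "emeasure (distr lborel borel (\<lambda>x. a i + c * x)) (A i) = emeasure lborel (?B i)"
        using A[OF that] by (subst emeasure_distr) auto
      finally show ?thesis .
    qed
    then have "(\<Prod>i\<in>I. emeasure lborel (A i))
        = ennreal (\<bar>c\<bar> ^ card I) * (\<Prod>i\<in>I. emeasure lborel (?B i))"
      by (simp add: prod.distrib ennreal_power)
    also have "(\<Prod>i\<in>I. emeasure lborel (?B i)) = emeasure ?L (Pi\<^sub>E I ?B)"
      using B I by (subst emeasure_PiM) auto
    also have "Pi\<^sub>E I ?B = ?T -` Pi\<^sub>E I A \<inter> space ?L"
      by (auto simp: space_PiM PiE_iff)
    finally show "emeasure (density (distr ?L ?L ?T) (\<lambda>_. ennreal (\<bar>c\<bar> ^ card I))) (Pi\<^sub>E I A)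
        = (\<Prod>i\<in>I. emeasure lborel (A i))"
      using box by (subst emeasure_density_const) (auto simp: emeasure_distr)
  qed simp
  then have "(\<integral>\<^sup>+x. f x \<partial>?L)
      = (\<integral>\<^sup>+x. f x \<partial>density (distr ?L ?L ?T) (\<lambda>_. ennreal (\<bar>c\<bar> ^ card I)))"
    by simp
  also have "\<dots> = (\<integral>\<^sup>+x. ennreal (\<bar>c\<bar> ^ card I) * f x \<partial>distr ?L ?L ?T)"
    using f by (subst nn_integral_density) auto
  also have "\<dots> = ennreal (\<bar>c\<bar> ^ card I) * (\<integral>\<^sup>+x. f x \<partial>distr ?L ?L ?T)"
    using f by (subst nn_integral_cmult) auto
  also have "(\<integral>\<^sup>+x. f x \<partial>distr ?L ?L ?T) = (\<integral>\<^sup>+x. f (?T x) \<partial>?L)"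
    using f by (subst nn_integral_distr) auto
  finally show ?thesis .
qed

text \<open>Functions in the product space are extensional, so they are determined by the values
  that \<open>Matrix.mat\<close> reads. On all functions it would not be injective, which is why the
  embedding rules relative to a set are used.\<close>

lemma inj_on_mat_PiM:
  "inj_on (Matrix.mat m q) (space (\<Pi>\<^sub>M ij \<in> {0..<m} \<times> {0..<q}. (lborel :: real measure)))"
proof (rule inj_onI)
  fix f g :: "nat \<times> nat \<Rightarrow> real"
  assume fg: "f \<in> space (\<Pi>\<^sub>M ij \<in> {0..<m} \<times> {0..<q}. lborel)"
      "g \<in> space (\<Pi>\<^sub>M ij \<in> {0..<m} \<times> {0..<q}. lborel)"
    and eq: "Matrix.mat m q f = Matrix.mat m q g"
  show "f = g"
  proof (rule PiE_ext)
    show "f \<in> Pi\<^sub>E ({0..<m} \<times> {0..<q}) (\<lambda>_. UNIV)" "g \<in> Pi\<^sub>E ({0..<m} \<times> {0..<q}) (\<lambda>_. UNIV)"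
      using fg by (auto simp: space_PiM)
    fix ij assume "ij \<in> {0..<m} \<times> {0..<q}"
    then show "f ij = g ij"
      using arg_cong[OF eq, of "\<lambda>X. X $$ ij"] by auto
  qed
qed

lemmas measurable_mat_PiM = measurable_embed_measure2'[OF inj_on_mat_PiM, folded mat_lebesgue_def]

lemma measurable_mat_entry:
  assumes "i < m" "j < q"
  shows "(\<lambda>X. X $$ (i, j)) \<in> borel_measurable (mat_lebesgue m q)"
  unfolding mat_lebesgue_def
proof (rule measurable_embed_measure1)
  have "(\<lambda>x. x (i, j)) \<in> borel_measurable (\<Pi>\<^sub>M ij \<in> {0..<m} \<times> {0..<q}. (lborel :: real measure))"
    using assms measurable_component_singleton[of "(i, j)" "{0..<m} \<times> {0..<q}" "\<lambda>_. lborel :: real measure"]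
    by simp
  then show "(\<lambda>x. Matrix.mat m q x $$ (i, j)) \<in> borel_measurable
      (\<Pi>\<^sub>M ij \<in> {0..<m} \<times> {0..<q}. (lborel :: real measure))"
    using assms by simp
qed

text \<open>Reduces measurability of matrix-valued maps to that of real entries. The carrier
  condition has to be stated separately, because the entries alone do not fix the
  dimensions.\<close>

lemma measurable_mat_lebesgue_iff:
  "f \<in> N \<rightarrow>\<^sub>M mat_lebesgue m q \<longleftrightarrow> f \<in> space N \<rightarrow> carrier_mat m q \<and>
     (\<forall>i<m. \<forall>j<q. (\<lambda>x. f x $$ (i, j)) \<in> borel_measurable N)"
  (is "?l \<longleftrightarrow> ?c \<and> ?e")
proof (intro iffI conjI)
  assume f: ?l
  show ?c using measurable_space[OF f] by (auto simp: space_mat_lebesgue)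
  show ?e using measurable_compose[OF f measurable_mat_entry] by blast
next
  assume a: "?c \<and> ?e"
  let ?g = "\<lambda>x. \<lambda>ij\<in>{0..<m} \<times> {0..<q}. f x $$ ij"
  have "?g \<in> N \<rightarrow>\<^sub>M (\<Pi>\<^sub>M ij \<in> {0..<m} \<times> {0..<q}. (lborel :: real measure))"
    using a by (intro measurable_restrict) auto
  then have "(\<lambda>x. Matrix.mat m q (?g x)) \<in> N \<rightarrow>\<^sub>M mat_lebesgue m q"
    by (rule measurable_compose[OF _ measurable_mat_PiM])
  moreover have "Matrix.mat m q (?g x) = f x" if "x \<in> space N" for x
    using a that by (intro eq_matI) (auto simp: Pi_iff)
  ultimately show ?l
    by (subst measurable_cong) auto
qed

lemma measurable_mat_lebesgueI:
  assumes "\<And>x. x \<in> space N \<Longrightarrow> f x \<in> carrier_mat m q"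
    and "\<And>i j. i < m \<Longrightarrow> j < q \<Longrightarrow> (\<lambda>x. f x $$ (i, j)) \<in> borel_measurable N"
  shows "f \<in> N \<rightarrow>\<^sub>M mat_lebesgue m q"
  using assms by (auto simp: measurable_mat_lebesgue_iff)

lemma measurable_mat_lebesgueD:
  assumes "f \<in> N \<rightarrow>\<^sub>M mat_lebesgue m q"
  shows "\<And>x. x \<in> space N \<Longrightarrow> f x \<in> carrier_mat m q"
    and "\<And>i j. i < m \<Longrightarrow> j < q \<Longrightarrow> (\<lambda>x. f x $$ (i, j)) \<in> borel_measurable N"
  using assms by (auto simp: measurable_mat_lebesgue_iff)

lemma nn_integral_mat_lebesgue:
  assumes "f \<in> borel_measurable (mat_lebesgue m q)"
  shows "(\<integral>\<^sup>+X. f X \<partial>mat_lebesgue m q)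
    = (\<integral>\<^sup>+x. f (Matrix.mat m q x) \<partial>(\<Pi>\<^sub>M ij \<in> {0..<m} \<times> {0..<q}. lborel))"
  using assms nn_integral_embed_measure'[OF inj_on_mat_PiM] by (simp add: mat_lebesgue_def)

text \<open>Two cases matter later: c = -1 for the reflection about the posterior centre, and c =
  sqrt 2 for the rescaling in the moment bound.\<close>

lemma nn_integral_mat_lebesgue_affine:
  fixes c :: real
  assumes c: "c \<noteq> 0" and Mu: "Mu \<in> carrier_mat m q"
    and f: "f \<in> borel_measurable (mat_lebesgue m q)"
  shows "(\<integral>\<^sup>+X. f X \<partial>mat_lebesgue m q)
    = ennreal (\<bar>c\<bar> ^ (m * q)) * (\<integral>\<^sup>+X. f (Mu + c \<cdot>\<^sub>m X) \<partial>mat_lebesgue m q)"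
proof -
  let ?I = "{0..<m} \<times> {0..<q}"
  let ?L = "\<Pi>\<^sub>M ij \<in> ?I. (lborel :: real measure)"
  have aff: "(\<lambda>X. Mu + c \<cdot>\<^sub>m X) \<in> mat_lebesgue m q \<rightarrow>\<^sub>M mat_lebesgue m q"
  proof (rule measurable_mat_lebesgueI)
    fix i j assume ij: "i < m" "j < q"
    have "(\<lambda>X. Mu $$ (i, j) + c * X $$ (i, j)) \<in> borel_measurable (mat_lebesgue m q)"
      using measurable_mat_entry[OF ij] by measurable
    then show "(\<lambda>X. (Mu + c \<cdot>\<^sub>m X) $$ (i, j)) \<in> borel_measurable (mat_lebesgue m q)"
      by (subst measurable_cong) (use ij Mu in \<open>auto simp: space_mat_lebesgue\<close>)
  qed (use Mu in \<open>auto simp: space_mat_lebesgue\<close>)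
  have "(\<integral>\<^sup>+X. f X \<partial>mat_lebesgue m q) = (\<integral>\<^sup>+x. f (Matrix.mat m q x) \<partial>?L)"
    by (rule nn_integral_mat_lebesgue[OF f])
  also have "\<dots> = ennreal (\<bar>c\<bar> ^ card ?I)
      * (\<integral>\<^sup>+x. f (Matrix.mat m q (\<lambda>ij\<in>?I. Mu $$ ij + c * x ij)) \<partial>?L)"
    using measurable_compose[OF measurable_mat_PiM f] c
    by (intro nn_integral_PiM_lborel_affine) auto
  also have "(\<integral>\<^sup>+x. f (Matrix.mat m q (\<lambda>ij\<in>?I. Mu $$ ij + c * x ij)) \<partial>?L)
      = (\<integral>\<^sup>+x. f (Mu + c \<cdot>\<^sub>m Matrix.mat m q x) \<partial>?L)"
    using Mu by (intro nn_integral_cong arg_cong[of _ _ f] eq_matI) auto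
  also have "\<dots> = (\<integral>\<^sup>+X. f (Mu + c \<cdot>\<^sub>m X) \<partial>mat_lebesgue m q)"
    using measurable_compose[OF aff f] by (intro nn_integral_mat_lebesgue[symmetric])
  finally show ?thesis by (simp add: card_cartesian_product)
qed

lemma sigma_finite_mat_lebesgue: "sigma_finite_measure (mat_lebesgue m q)"
proof -
  let ?I = "{0..<m} \<times> {0..<q}"
  let ?L = "\<Pi>\<^sub>M ij \<in> ?I. (lborel :: real measure)"
  interpret product_sigma_finite "\<lambda>_. lborel :: real measure"
    by standard
  interpret L: sigma_finite_measure ?L
    by (rule sigma_finite) simp
  obtain A where A: "countable A" "A \<subseteq> sets ?L" "\<Union>A = space ?L" "\<forall>a\<in>A. emeasure ?L a \<noteq> \<infinity>"
    using L.sigma_finite_countable by auto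
  show ?thesis
  proof
    show "\<exists>A'. countable A' \<and> A' \<subseteq> sets (mat_lebesgue m q) \<and> \<Union>A' = space (mat_lebesgue m q)
        \<and> (\<forall>a\<in>A'. emeasure (mat_lebesgue m q) a \<noteq> \<infinity>)"
    proof (intro exI[of _ "(`) (Matrix.mat m q) ` A"] conjI ballI)
      show "\<Union>((`) (Matrix.mat m q) ` A) = space (mat_lebesgue m q)"
        unfolding mat_lebesgue_def space_embed_measure A(3)[symmetric] by blast
      fix a assume "a \<in> (`) (Matrix.mat m q) ` A"
      then show "emeasure (mat_lebesgue m q) a \<noteq> \<infinity>"
        using A emeasure_embed_measure_image'[OF inj_on_mat_PiM]
        by (auto simp: mat_lebesgue_def)
    qed (use A in \<open>auto simp: mat_lebesgue_def in_sets_embed_measure\<close>)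
  qed
qed

section \<open>Measurability of matrix operations\<close>

named_theorems mat_meas

text \<open>The entry formula is valid only for factors of matching size, hence only on the space of
  \<open>N\<close>; the measurable sum is therefore exchanged for the entry by
  \<open>measurable_cong\<close>. Most of the closure rules below follow this pattern.\<close>

lemma mat_meas_mult[mat_meas]:
  assumes f: "f \<in> N \<rightarrow>\<^sub>M mat_lebesgue m r" and g: "g \<in> N \<rightarrow>\<^sub>M mat_lebesgue r q"
  shows "(\<lambda>x. f x * g x) \<in> N \<rightarrow>\<^sub>M mat_lebesgue m q"
proof (rule measurable_mat_lebesgueI)
  note fD = measurable_mat_lebesgueD[OF f] and gD = measurable_mat_lebesgueD[OF g]
  show "f x * g x \<in> carrier_mat m q" if "x \<in> space N" for x
    using fD(1)[OF that] gD(1)[OF that] by simp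
  fix i j assume ij: "i < m" "j < q"
  have "(\<lambda>x. \<Sum>l = 0..<r. f x $$ (i, l) * g x $$ (l, j)) \<in> borel_measurable N"
    using fD(2) gD(2) ij by (intro borel_measurable_sum borel_measurable_times) auto
  then show "(\<lambda>x. (f x * g x) $$ (i, j)) \<in> borel_measurable N"
  proof (rule measurable_cong[THEN iffD1, rotated])
    fix x assume "x \<in> space N"
    then show "(\<Sum>l = 0..<r. f x $$ (i, l) * g x $$ (l, j)) = (f x * g x) $$ (i, j)"
      using fD(1)[of x] gD(1)[of x] ij by (auto simp: scalar_prod_def)
  qed
qed

lemma mat_meas_diff[mat_meas]:
  assumes f: "f \<in> N \<rightarrow>\<^sub>M mat_lebesgue m q" and g: "g \<in> N \<rightarrow>\<^sub>M mat_lebesgue m q"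
  shows "(\<lambda>x. f x - g x) \<in> N \<rightarrow>\<^sub>M mat_lebesgue m q"
proof (rule measurable_mat_lebesgueI)
  note fD = measurable_mat_lebesgueD[OF f] and gD = measurable_mat_lebesgueD[OF g]
  show "f x - g x \<in> carrier_mat m q" if "x \<in> space N" for x
    using fD(1)[OF that] gD(1)[OF that] by auto
  fix i j assume ij: "i < m" "j < q"
  have "(\<lambda>x. f x $$ (i, j) - g x $$ (i, j)) \<in> borel_measurable N"
    using fD(2) gD(2) ij by (intro borel_measurable_diff) auto
  then show "(\<lambda>x. (f x - g x) $$ (i, j)) \<in> borel_measurable N"
  proof (rule measurable_cong[THEN iffD1, rotated])
    fix x assume "x \<in> space N"
    then show "f x $$ (i, j) - g x $$ (i, j) = (f x - g x) $$ (i, j)"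
      using fD(1)[of x] gD(1)[of x] ij by auto
  qed
qed

lemma mat_meas_smult[mat_meas]:
  assumes a: "a \<in> borel_measurable N" and f: "f \<in> N \<rightarrow>\<^sub>M mat_lebesgue m q"
  shows "(\<lambda>x. a x \<cdot>\<^sub>m f x) \<in> N \<rightarrow>\<^sub>M mat_lebesgue m q"
proof (rule measurable_mat_lebesgueI)
  note fD = measurable_mat_lebesgueD[OF f]
  show "a x \<cdot>\<^sub>m f x \<in> carrier_mat m q" if "x \<in> space N" for x
    using fD(1)[OF that] by simp
  fix i j assume ij: "i < m" "j < q"
  have "(\<lambda>x. a x * f x $$ (i, j)) \<in> borel_measurable N"
    using fD(2) a ij by (intro borel_measurable_times) auto
  then show "(\<lambda>x. (a x \<cdot>\<^sub>m f x) $$ (i, j)) \<in> borel_measurable N"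
  proof (rule measurable_cong[THEN iffD1, rotated])
    fix x assume "x \<in> space N"
    then show "a x * f x $$ (i, j) = (a x \<cdot>\<^sub>m f x) $$ (i, j)"
      using fD(1)[of x] ij by auto
  qed
qed

lemma mat_meas_transpose[mat_meas]:
  assumes f: "f \<in> N \<rightarrow>\<^sub>M mat_lebesgue m q"
  shows "(\<lambda>x. transpose_mat (f x)) \<in> N \<rightarrow>\<^sub>M mat_lebesgue q m"
proof (rule measurable_mat_lebesgueI)
  note fD = measurable_mat_lebesgueD[OF f]
  show "transpose_mat (f x) \<in> carrier_mat q m" if "x \<in> space N" for x
    using fD(1)[OF that] by simp
  fix i j assume ij: "i < q" "j < m"
  show "(\<lambda>x. transpose_mat (f x) $$ (i, j)) \<in> borel_measurable N"
  proof (rule measurable_cong[THEN iffD1, OF _ fD(2)[OF ij(2,1)]])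
    fix x assume "x \<in> space N"
    then show "f x $$ (j, i) = transpose_mat (f x) $$ (i, j)"
      using fD(1)[of x] ij by auto
  qed
qed

lemma mat_meas_const[mat_meas]:
  "X \<in> carrier_mat m q \<Longrightarrow> (\<lambda>_. X) \<in> N \<rightarrow>\<^sub>M mat_lebesgue m q"
  by (intro measurable_const) (simp add: space_mat_lebesgue)

lemma mat_meas_trace[mat_meas]:
  assumes f: "f \<in> N \<rightarrow>\<^sub>M mat_lebesgue m m"
  shows "(\<lambda>x. mat_trace (f x)) \<in> borel_measurable N"
proof -
  note fD = measurable_mat_lebesgueD[OF f]
  have "(\<lambda>x. \<Sum>i<m. f x $$ (i, i)) \<in> borel_measurable N"
    using fD(2) by (intro borel_measurable_sum) auto
  then show ?thesis
  proof (rule measurable_cong[THEN iffD1, rotated])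
    fix x assume "x \<in> space N"
    then show "(\<Sum>i<m. f x $$ (i, i)) = mat_trace (f x)"
      using fD(1)[of x] by (simp add: mat_trace_def)
  qed
qed

text \<open>By the Leibniz formula the determinant is a polynomial in the entries.\<close>

lemma mat_meas_det[mat_meas]:
  assumes f: "f \<in> N \<rightarrow>\<^sub>M mat_lebesgue m m"
  shows "(\<lambda>x. Determinant.det (f x)) \<in> borel_measurable N"
proof -
  note fD = measurable_mat_lebesgueD[OF f]
  have "(\<lambda>x. \<Sum>p\<in>{p. p permutes {0..<m}}. signof p * (\<Prod>i = 0..<m. f x $$ (i, p i)))
      \<in> borel_measurable N"
  proof (intro borel_measurable_sum borel_measurable_times borel_measurable_prod)
    fix p i assume "p \<in> {p. p permutes {0..<m}}" "i \<in> {0..<m}"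
    then show "(\<lambda>x. f x $$ (i, p i)) \<in> borel_measurable N"
      using fD(2)[of i "p i"] permutes_in_image[of p "{0..<m}" i] by auto
  qed auto
  then show ?thesis
  proof (rule measurable_cong[THEN iffD1, rotated])
    fix x assume "x \<in> space N"
    then show "(\<Sum>p\<in>{p. p permutes {0..<m}}. signof p * (\<Prod>i = 0..<m. f x $$ (i, p i)))
        = Determinant.det (f x)"
      using det_def'[OF fD(1)[of x]] by simp
  qed
qed

text \<open>For square matrices a right inverse is two-sided, so the elimination procedure behind
  \<open>mat_inverse\<close> succeeds and its result must be \<open>B\<close>.\<close>

lemma mat_inv_eqI:
  assumes A: "A \<in> carrier_mat m m" and B: "B \<in> carrier_mat m m" and AB: "A * B = 1\<^sub>m m"
  shows "mat_inv A = B"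
proof -
  have BA: "B * A = 1\<^sub>m m"
    using mat_mult_left_right_inverse[OF A B AB] .
  have "A \<in> Units (ring_mat TYPE(real) m ())"
    using A B AB BA by (auto simp: Units_def ring_mat_def)
  then obtain Z where Z: "mat_inverse A = Some Z"
    using mat_inverse(1)[OF A, of "()"] by (cases "mat_inverse A") auto
  then have "Z * A = 1\<^sub>m m" "Z \<in> carrier_mat m m"
    using mat_inverse(2)[OF A Z] by auto
  have "Z = Z * (A * B)"
    using AB \<open>Z \<in> _\<close> by simp
  also have "\<dots> = B"
    using A B \<open>Z \<in> _\<close> \<open>Z * A = 1\<^sub>m m\<close> by (simp flip: assoc_mult_mat)
  finally show ?thesis
    using Z by (simp add: mat_inv_def)
qed

text \<open>Replaces an inverse computed by elimination by Cramer's formula. This makes it a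
  rational function of the entries, which is what its measurability rests on; the singular branch is
  the default value in \<open>mat_inv\<close>.\<close>

lemma mat_inv_eq_adj:
  assumes A: "A \<in> carrier_mat m m"
  shows "mat_inv A = (if Determinant.det A = 0 then 0\<^sub>m m m else (1 / Determinant.det A) \<cdot>\<^sub>m adj_mat A)"
proof (cases "Determinant.det A = 0")
  case True
  have "mat_inverse A = None"
  proof (rule ccontr)
    assume "mat_inverse A \<noteq> None"
    then obtain Z where "mat_inverse A = Some Z" by auto
    from mat_inverse(2)[OF A this] have Z: "A * Z = 1\<^sub>m m" "Z \<in> carrier_mat m m" by auto
    have "Determinant.det A * Determinant.det Z = 1"
      using det_mult[OF A Z(2)] Z(1) by simp
    with True show False by simp
  qed
  with True A show ?thesis by (simp add: mat_inv_def)
next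
  case False
  have "A * ((1 / Determinant.det A) \<cdot>\<^sub>m adj_mat A) = 1\<^sub>m m"
    using False A adj_mat[OF A] by (subst mult_smult_distrib[OF A]) auto
  from mat_inv_eqI[OF A _ this] show ?thesis
    using False adj_mat(1)[OF A] by simp
qed

lemma mat_inv_carrier[simp]: "A \<in> carrier_mat m m \<Longrightarrow> mat_inv A \<in> carrier_mat m m"
  using adj_mat(1)[of A m] by (simp add: mat_inv_eq_adj)

lemma mat_inv_mult:
  assumes A: "A \<in> carrier_mat m m" and "Determinant.det A \<noteq> 0"
  shows "A * mat_inv A = 1\<^sub>m m" "mat_inv A * A = 1\<^sub>m m"
  using assms adj_mat[OF A]
  by (auto simp: mat_inv_eq_adj mult_smult_distrib[OF A adj_mat(1)[OF A]]
      mult_smult_assoc_mat[OF adj_mat(1)[OF A] A])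

lemma mat_meas_inv[mat_meas]:
  assumes f: "f \<in> N \<rightarrow>\<^sub>M mat_lebesgue m m"
  shows "(\<lambda>x. mat_inv (f x)) \<in> N \<rightarrow>\<^sub>M mat_lebesgue m m"
proof -
  note fD = measurable_mat_lebesgueD[OF f]
  have adj: "(\<lambda>x. adj_mat (f x)) \<in> N \<rightarrow>\<^sub>M mat_lebesgue m m"
  proof (rule measurable_mat_lebesgueI)
    show "adj_mat (f x) \<in> carrier_mat m m" if "x \<in> space N" for x
      using adj_mat(1)[OF fD(1)[OF that]] .
    fix i j assume ij: "i < m" "j < m"
    \<comment> \<open>Entry (i, j) of the adjugate is the cofactor at (j, i), so row j and column i
      are the ones deleted.\<close>
    have "(\<lambda>x. mat_delete (f x) j i) \<in> N \<rightarrow>\<^sub>M mat_lebesgue (m - 1) (m - 1)"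
    proof (rule measurable_mat_lebesgueI)
      show "mat_delete (f x) j i \<in> carrier_mat (m - 1) (m - 1)" if "x \<in> space N" for x
        using mat_delete_carrier[OF fD(1)[OF that]] .
      fix a b assume ab: "a < m - 1" "b < m - 1"
      \<comment> \<open>Positions in the original matrix: indices at or beyond the deleted row or
        column move up by one.\<close>
      define a' b' where "a' = (if a < j then a else Suc a)" and "b' = (if b < i then b else Suc b)"
      have "a' < m" "b' < m" using ab by (auto simp: a'_def b'_def)
      show "(\<lambda>x. mat_delete (f x) j i $$ (a, b)) \<in> borel_measurable N"
      proof (rule measurable_cong[THEN iffD1, OF _ fD(2)[OF \<open>a' < m\<close> \<open>b' < m\<close>]])
        fix x assume "x \<in> space N"
        then show "f x $$ (a', b') = mat_delete (f x) j i $$ (a, b)"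
          using fD(1)[of x] ab by (auto simp: mat_delete_def a'_def b'_def)
      qed
    qed
    then have "(\<lambda>x. (-1) ^ (j + i) * Determinant.det (mat_delete (f x) j i)) \<in> borel_measurable N"
      by (intro borel_measurable_times mat_meas) auto
    then show "(\<lambda>x. adj_mat (f x) $$ (i, j)) \<in> borel_measurable N"
    proof (rule measurable_cong[THEN iffD1, rotated])
      fix x assume "x \<in> space N"
      then show "(-1) ^ (j + i) * Determinant.det (mat_delete (f x) j i) = adj_mat (f x) $$ (i, j)"
        using fD(1)[of x] ij by (auto simp: adj_mat_def cofactor_def)
    qed
  qed
  have D[measurable]: "(\<lambda>x. Determinant.det (f x)) \<in> borel_measurable N"
    using f by (rule mat_meas)
  have "(\<lambda>x. if Determinant.det (f x) = 0 then 0\<^sub>m m m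
      else (1 / Determinant.det (f x)) \<cdot>\<^sub>m adj_mat (f x)) \<in> N \<rightarrow>\<^sub>M mat_lebesgue m m"
    using adj by (intro measurable_If mat_meas) auto
  then show ?thesis
    by (rule measurable_cong[THEN iffD1, rotated]) (simp add: mat_inv_eq_adj[OF fD(1)])
qed

section \<open>Conditional expectation and Bayes estimators\<close>

lemma finite_measure_subalgebra_generated:
  assumes M: "finite_measure M" and T: "T \<in> M \<rightarrow>\<^sub>M N"
  shows "finite_measure_subalgebra M (generated_algebra M N T)"
proof -
  have sets: "sets (generated_algebra M N T) = {T -` A \<inter> space M |A. A \<in> sets N}"
    using measurable_space[OF T] by (intro sets_vimage_algebra2) auto
  interpret finite_measure M by fact
  show ?thesis
    by standard (auto simp: subalgebra_def sets intro: measurable_sets[OF T])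
qed

text \<open>Every set of the generated algebra is an event {T in A}, and a conditional expectation
  is characterised by its integrals over such events. Comparisons of posterior losses thereby become
  identities between plain integrals.\<close>

lemma nn_cond_exp_generated_cong:
  assumes M: "finite_measure M" and T: "T \<in> M \<rightarrow>\<^sub>M N"
    and f: "f \<in> borel_measurable M" and g: "g \<in> borel_measurable M"
    and eq: "\<And>A. A \<in> sets N \<Longrightarrow>
      (\<integral>\<^sup>+\<omega>. f \<omega> * indicator A (T \<omega>) \<partial>M) = (\<integral>\<^sup>+\<omega>. g \<omega> * indicator A (T \<omega>) \<partial>M)"
  shows "AE \<omega> in M. nn_cond_exp M (generated_algebra M N T) f \<omega>
    = nn_cond_exp M (generated_algebra M N T) g \<omega>"
proof -
  let ?F = "generated_algebra M N T"
  interpret finite_measure_subalgebra M ?F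
    by (rule finite_measure_subalgebra_generated[OF M T])
  have sets: "sets ?F = {T -` A \<inter> space M |A. A \<in> sets N}"
    using measurable_space[OF T] by (intro sets_vimage_algebra2) auto
  show ?thesis
  proof (rule AE_symmetric[OF nn_cond_exp_charact])
    fix A assume "A \<in> sets ?F"
    then obtain B where B: "B \<in> sets N" "A = T -` B \<inter> space M"
      by (auto simp: sets)
    have ind: "indicator A \<omega> = (indicator B (T \<omega>) :: ennreal)" if "\<omega> \<in> space M" for \<omega>
      using B that by (auto split: split_indicator)
    have "A \<in> sets M"
      using measurable_sets[OF T B(1)] B(2) by simp
    have "(\<integral>\<^sup>+\<omega>\<in>A. f \<omega> \<partial>M) = (\<integral>\<^sup>+\<omega>. g \<omega> * indicator A \<omega> \<partial>M)"
      using eq[OF B(1)] by (simp add: ind cong: nn_integral_cong)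
    also have "\<dots> = (\<integral>\<^sup>+\<omega>. indicator A \<omega> * nn_cond_exp M ?F g \<omega> \<partial>M)"
      using g \<open>A \<in> sets ?F\<close> by (subst nn_cond_exp_intg) (auto simp: mult.commute)
    finally show "(\<integral>\<^sup>+\<omega>\<in>A. f \<omega> \<partial>M) = (\<integral>\<^sup>+\<omega>\<in>A. nn_cond_exp M ?F g \<omega> \<partial>M)"
      by (simp add: mult.commute)
  qed (use f in auto)
qed

lemma nn_integral_nn_cond_exp_generated:
  assumes M: "finite_measure M" and T: "T \<in> M \<rightarrow>\<^sub>M N" and f: "f \<in> borel_measurable M"
  shows "(\<integral>\<^sup>+\<omega>. nn_cond_exp M (generated_algebra M N T) f \<omega> \<partial>M) = (\<integral>\<^sup>+\<omega>. f \<omega> \<partial>M)"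
    and "nn_cond_exp M (generated_algebra M N T) f \<in> borel_measurable M"
proof -
  let ?F = "generated_algebra M N T"
  interpret finite_measure_subalgebra M ?F
    by (rule finite_measure_subalgebra_generated[OF M T])
  show "(\<integral>\<^sup>+\<omega>. nn_cond_exp M ?F f \<omega> \<partial>M) = (\<integral>\<^sup>+\<omega>. f \<omega> \<partial>M)"
    using nn_cond_exp_intg[of "\<lambda>_. 1" f] f by simp
  show "nn_cond_exp M ?F f \<in> borel_measurable M" by simp
qed

lemma nn_cond_exp_generated_mono:
  assumes M: "finite_measure M" and T: "T \<in> M \<rightarrow>\<^sub>M N"
    and f: "f \<in> borel_measurable M" and g: "g \<in> borel_measurable M"
    and le: "\<And>\<omega>. f \<omega> \<le> g \<omega>"
  shows "AE \<omega> in M. nn_cond_exp M (generated_algebra M N T) f \<omega>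
    \<le> nn_cond_exp M (generated_algebra M N T) g \<omega>"
proof -
  let ?F = "generated_algebra M N T"
  interpret finite_measure_subalgebra M ?F
    by (rule finite_measure_subalgebra_generated[OF M T])
  show ?thesis
    by (rule nn_cond_exp_mono) (use assms in auto)
qed

text \<open>Here \<open>q\<close> is the excess loss over \<open>\<Phi>\<close>; \<open>fin\<close> and \<open>zero\<close> serve only uniqueness.\<close>
lemma is_the_bayes_estimatorI:
  assumes M: "finite_measure M" and T: "T \<in> M \<rightarrow>\<^sub>M N" and \<Phi>: "\<Phi> \<in> N \<rightarrow>\<^sub>M E"
    and L: "\<And>\<Phi>'. \<Phi>' \<in> N \<rightarrow>\<^sub>M E \<Longrightarrow> (\<lambda>\<omega>. ennreal (L \<omega> (\<Phi>' (T \<omega>)))) \<in> borel_measurable M"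
    and q: "\<And>\<Phi>'. \<Phi>' \<in> N \<rightarrow>\<^sub>M E \<Longrightarrow> q \<Phi>' \<in> borel_measurable M"
    and decomp: "\<And>\<Phi>' A. \<Phi>' \<in> N \<rightarrow>\<^sub>M E \<Longrightarrow> A \<in> sets N \<Longrightarrow>
      (\<integral>\<^sup>+\<omega>. ennreal (L \<omega> (\<Phi>' (T \<omega>))) * indicator A (T \<omega>) \<partial>M)
        = (\<integral>\<^sup>+\<omega>. (ennreal (L \<omega> (\<Phi> (T \<omega>))) + q \<Phi>' \<omega>) * indicator A (T \<omega>) \<partial>M)"
    and fin: "(\<integral>\<^sup>+\<omega>. ennreal (L \<omega> (\<Phi> (T \<omega>))) \<partial>M) < \<infinity>"
    and zero: "\<And>\<Phi>'. \<Phi>' \<in> N \<rightarrow>\<^sub>M E \<Longrightarrow> AE \<omega> in M. q \<Phi>' \<omega> = 0 \<longrightarrow> \<Phi>' (T \<omega>) = \<Phi> (T \<omega>)"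
  shows "is_the_bayes_estimator M N T E L \<Phi>"
proof -
  let ?F = "generated_algebra M N T"
  let ?L = "\<lambda>\<Phi> \<omega>. ennreal (L \<omega> (\<Phi> (T \<omega>)))"
  have "AE \<omega> in M. posterior_expected_loss M N T L \<Phi> \<omega> \<le> posterior_expected_loss M N T L \<Phi>' \<omega>"
    if \<Phi>': "\<Phi>' \<in> N \<rightarrow>\<^sub>M E" for \<Phi>'
  proof -
    have "AE \<omega> in M. nn_cond_exp M ?F (?L \<Phi>') \<omega>
        = nn_cond_exp M ?F (\<lambda>\<omega>. ?L \<Phi> \<omega> + q \<Phi>' \<omega>) \<omega>"
      using L[OF \<Phi>] L[OF \<Phi>'] q[OF \<Phi>'] decomp[OF \<Phi>']
      by (intro nn_cond_exp_generated_cong[OF M T]) auto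
    moreover have "AE \<omega> in M. nn_cond_exp M ?F (?L \<Phi>) \<omega>
        \<le> nn_cond_exp M ?F (\<lambda>\<omega>. ?L \<Phi> \<omega> + q \<Phi>' \<omega>) \<omega>"
      using L[OF \<Phi>] q[OF \<Phi>'] by (intro nn_cond_exp_generated_mono[OF M T]) auto
    ultimately show ?thesis
      unfolding posterior_expected_loss_def by eventually_elim simp
  qed
  with \<Phi> have "is_bayes_estimator M N T E L \<Phi>"
    by (simp add: is_bayes_estimator_def)
  moreover have "AE \<omega> in M. \<Phi>' (T \<omega>) = \<Phi> (T \<omega>)"
    if bayes: "is_bayes_estimator M N T E L \<Phi>'" for \<Phi>'
  proof -
    from bayes have \<Phi>': "\<Phi>' \<in> N \<rightarrow>\<^sub>M E"
      by (simp add: is_bayes_estimator_def)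
    \<comment> \<open>Taken over the whole space, the decomposition says that the risk of
      \<open>\<Phi>'\<close> is the risk of \<open>\<Phi>\<close> plus the integral of the excess.
      Optimality of \<open>\<Phi>'\<close> against the competitor \<open>\<Phi>\<close> bounds that
      sum by the risk of \<open>\<Phi>\<close>, which cancels because it is finite.\<close>
    have top: "space N \<in> sets N" by simp
    have ind: "indicator (space N) (T \<omega>) = (1 :: ennreal)" if "\<omega> \<in> space M" for \<omega>
      using measurable_space[OF T that] by simp
    have "(\<integral>\<^sup>+\<omega>. ?L \<Phi> \<omega> \<partial>M) + (\<integral>\<^sup>+\<omega>. q \<Phi>' \<omega> \<partial>M) = (\<integral>\<^sup>+\<omega>. ?L \<Phi>' \<omega> \<partial>M)"
      using decomp[OF \<Phi>' top] L[OF \<Phi>] q[OF \<Phi>']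
      by (simp add: ind nn_integral_add cong: nn_integral_cong)
    also have "\<dots> = (\<integral>\<^sup>+\<omega>. nn_cond_exp M ?F (?L \<Phi>') \<omega> \<partial>M)"
      using nn_integral_nn_cond_exp_generated(1)[OF M T L[OF \<Phi>']] by simp
    also have "\<dots> \<le> (\<integral>\<^sup>+\<omega>. nn_cond_exp M ?F (?L \<Phi>) \<omega> \<partial>M)"
      using bayes \<Phi> by (intro nn_integral_mono_AE)
        (auto simp: is_bayes_estimator_def posterior_expected_loss_def)
    also have "\<dots> = (\<integral>\<^sup>+\<omega>. ?L \<Phi> \<omega> \<partial>M)"
      using nn_integral_nn_cond_exp_generated(1)[OF M T L[OF \<Phi>]] .
    finally have "(\<integral>\<^sup>+\<omega>. ?L \<Phi> \<omega> \<partial>M) + (\<integral>\<^sup>+\<omega>. q \<Phi>' \<omega> \<partial>M)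
        \<le> (\<integral>\<^sup>+\<omega>. ?L \<Phi> \<omega> \<partial>M) + 0"
      by simp
    then have "(\<integral>\<^sup>+\<omega>. q \<Phi>' \<omega> \<partial>M) = 0"
      using fin unfolding ennreal_add_left_cancel_le by (auto simp: less_top)
    then have "AE \<omega> in M. q \<Phi>' \<omega> = 0"
      using q[OF \<Phi>'] by (simp add: nn_integral_0_iff_AE)
    with zero[OF \<Phi>'] show ?thesis by eventually_elim simp
  qed
  ultimately show ?thesis
    by (simp add: is_the_bayes_estimator_def)
qed

text \<open>A conditional distribution prescribes the joint law of (X, Z) on rectangles only.
  Rectangles form a generator stable under intersection and the joint law is finite, so it coincides
  with the measure of density \<open>f\<close> with respect to the product of \<open>MX\<close> and
  the law of \<open>Z\<close>. Joint measurability of \<open>f\<close> is what allows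
  Fubini.\<close>

lemma nn_integral_has_cond_distr_density:
  assumes M: "finite_measure M" and cd: "has_cond_distr M MX X MZ Z K"
    and MX: "sigma_finite_measure MX"
    and K: "\<And>z. z \<in> space MZ \<Longrightarrow> K z = density MX (f z)"
    and f: "(\<lambda>(x, z). f z x) \<in> borel_measurable (MX \<Otimes>\<^sub>M MZ)"
    and h: "h \<in> borel_measurable (MX \<Otimes>\<^sub>M MZ)"
  shows "(\<integral>\<^sup>+\<omega>. h (X \<omega>, Z \<omega>) \<partial>M) = (\<integral>\<^sup>+\<omega>. (\<integral>\<^sup>+x. f (Z \<omega>) x * h (x, Z \<omega>) \<partial>MX) \<partial>M)"
proof -
  interpret M: finite_measure M by fact
  from cd have X[measurable]: "X \<in> M \<rightarrow>\<^sub>M MX" and Z[measurable]: "Z \<in> M \<rightarrow>\<^sub>M MZ"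
    and joint: "\<And>A B. A \<in> sets MX \<Longrightarrow> B \<in> sets MZ \<Longrightarrow>
      emeasure M {\<omega> \<in> space M. X \<omega> \<in> A \<and> Z \<omega> \<in> B}
        = (\<integral>\<^sup>+\<omega>. emeasure (K (Z \<omega>)) A * indicator B (Z \<omega>) \<partial>M)"
    by (auto simp: has_cond_distr_def)
  let ?Q = "distr M MZ Z"
  interpret Q: finite_measure ?Q by (rule M.finite_measure_distr) simp
  interpret pair_sigma_finite MX ?Q
    using MX Q.sigma_finite_measure_axioms by (simp add: pair_sigma_finite_def)
  let ?D1 = "distr M (MX \<Otimes>\<^sub>M MZ) (\<lambda>\<omega>. (X \<omega>, Z \<omega>))"
  let ?D2 = "density (MX \<Otimes>\<^sub>M ?Q) (\<lambda>(x, z). f z x)"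
  have sets_eq: "sets (MX \<Otimes>\<^sub>M ?Q) = sets (MX \<Otimes>\<^sub>M MZ)"
    by (intro sets_pair_measure_cong) auto
  note meas_eq = measurable_cong_sets[OF sets_eq refl]
  have f'[measurable]: "(\<lambda>(x, z). f z x) \<in> borel_measurable (MX \<Otimes>\<^sub>M ?Q)"
    using f by (simp add: meas_eq)
  \<comment> \<open>Used twice: for indicators of rectangles, to identify the two measures, and at
    the end for \<open>h\<close> itself.\<close>
  have fubini: "(\<integral>\<^sup>+xz. u xz \<partial>?D2) = (\<integral>\<^sup>+\<omega>. (\<integral>\<^sup>+x. f (Z \<omega>) x * u (x, Z \<omega>) \<partial>MX) \<partial>M)"
    if u: "u \<in> borel_measurable (MX \<Otimes>\<^sub>M MZ)" for u
  proof -
    have u'[measurable]: "u \<in> borel_measurable (MX \<Otimes>\<^sub>M ?Q)"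
      using u by (simp add: meas_eq)
    have "(\<integral>\<^sup>+xz. u xz \<partial>?D2) = (\<integral>\<^sup>+xz. (\<lambda>(x, z). f z x) xz * u xz \<partial>(MX \<Otimes>\<^sub>M ?Q))"
      by (intro nn_integral_density) auto
    also have "\<dots> = (\<integral>\<^sup>+z. (\<integral>\<^sup>+x. f z x * u (x, z) \<partial>MX) \<partial>?Q)"
      by (subst nn_integral_snd[symmetric]) auto
    also have "\<dots> = (\<integral>\<^sup>+\<omega>. (\<integral>\<^sup>+x. f (Z \<omega>) x * u (x, Z \<omega>) \<partial>MX) \<partial>M)"
    proof (rule nn_integral_distr[OF Z])
      have [measurable]: "(\<lambda>(x, z). f z x) \<in> borel_measurable (MX \<Otimes>\<^sub>M MZ)" and [measurable]: "u \<in> borel_measurable (MX \<Otimes>\<^sub>M MZ)"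
        by fact+
      have "(\<lambda>xz. (\<lambda>(x, z). f z x) xz * u xz) \<in> borel_measurable (MX \<Otimes>\<^sub>M MZ)"
        by measurable
      from measurable_compose[OF measurable_pair_swap' this]
      have "(\<lambda>(z, x). f z x * u (x, z)) \<in> borel_measurable (MZ \<Otimes>\<^sub>M MX)"
        by (simp add: case_prod_beta)
      then show "(\<lambda>z. \<integral>\<^sup>+x. f z x * u (x, z) \<partial>MX) \<in> borel_measurable ?Q"
        using sigma_finite_measure.borel_measurable_nn_integral[OF MX] by simp
    qed
    finally show ?thesis .
  qed
  have "?D1 = ?D2"
  proof (rule measure_eqI_generator_eq[where E = "{A \<times> B |A B. A \<in> sets MX \<and> B \<in> sets MZ}"
      and \<Omega> = "space MX \<times> space MZ" and A = "\<lambda>_. space MX \<times> space MZ"])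
    show "Int_stable {A \<times> B |A B. A \<in> sets MX \<and> B \<in> sets MZ}"
      by (rule Int_stable_pair_measure_generator)
    show "{A \<times> B |A B. A \<in> sets MX \<and> B \<in> sets MZ} \<subseteq> Pow (space MX \<times> space MZ)"
      by (rule pair_measure_closed)
    show "sets ?D1 = sigma_sets (space MX \<times> space MZ) {A \<times> B |A B. A \<in> sets MX \<and> B \<in> sets MZ}"
      by (simp add: sets_pair_measure)
    show "sets ?D2 = sigma_sets (space MX \<times> space MZ) {A \<times> B |A B. A \<in> sets MX \<and> B \<in> sets MZ}"
      using sets_eq by (simp add: sets_pair_measure)
    interpret D1: finite_measure ?D1
      by (rule M.finite_measure_distr) simp
    show "emeasure ?D1 (space MX \<times> space MZ) \<noteq> \<infinity>"
      using D1.emeasure_finite by simp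
    fix S assume "S \<in> {A \<times> B |A B. A \<in> sets MX \<and> B \<in> sets MZ}"
    then obtain A B where S: "S = A \<times> B" and A[measurable]: "A \<in> sets MX" and B[measurable]: "B \<in> sets MZ"
      by auto
    have "emeasure ?D1 S = emeasure M {\<omega> \<in> space M. X \<omega> \<in> A \<and> Z \<omega> \<in> B}"
      unfolding S by (subst emeasure_distr) (auto intro!: arg_cong[of _ _ "emeasure M"])
    also have "\<dots> = (\<integral>\<^sup>+\<omega>. emeasure (K (Z \<omega>)) A * indicator B (Z \<omega>) \<partial>M)"
      by (rule joint) fact+
    also have "\<dots> = (\<integral>\<^sup>+\<omega>. (\<integral>\<^sup>+x. f (Z \<omega>) x * indicator S (x, Z \<omega>) \<partial>MX) \<partial>M)"
    proof (rule nn_integral_cong)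
      fix \<omega> assume "\<omega> \<in> space M"
      then have z: "Z \<omega> \<in> space MZ" by (rule measurable_space[OF Z])
      have fz: "f (Z \<omega>) \<in> borel_measurable MX"
        using measurable_compose[OF measurable_Pair2'[OF z] f] by simp
      have "emeasure (K (Z \<omega>)) A * indicator B (Z \<omega>)
          = (\<integral>\<^sup>+x. f (Z \<omega>) x * indicator A x \<partial>MX) * indicator B (Z \<omega>)"
        using fz A by (simp add: K[OF z] emeasure_density)
      also have "\<dots> = (\<integral>\<^sup>+x. f (Z \<omega>) x * indicator A x * indicator B (Z \<omega>) \<partial>MX)"
        using fz A by (subst nn_integral_multc) auto
      also have "\<dots> = (\<integral>\<^sup>+x. f (Z \<omega>) x * indicator S (x, Z \<omega>) \<partial>MX)"
        by (intro nn_integral_cong) (auto simp: S split: split_indicator)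
      finally show "emeasure (K (Z \<omega>)) A * indicator B (Z \<omega>)
          = (\<integral>\<^sup>+x. f (Z \<omega>) x * indicator S (x, Z \<omega>) \<partial>MX)" .
    qed
    also have "\<dots> = (\<integral>\<^sup>+xz. indicator S xz \<partial>?D2)"
      by (rule fubini[symmetric]) (simp add: S)
    also have "\<dots> = emeasure ?D2 S"
      by (rule nn_integral_indicator) (simp add: S sets_eq)
    finally show "emeasure ?D1 S = emeasure ?D2 S" .
  qed auto
  then have "(\<integral>\<^sup>+xz. h xz \<partial>?D1) = (\<integral>\<^sup>+xz. h xz \<partial>?D2)"
    by simp
  then show ?thesis
    using h by (simp add: fubini nn_integral_distr)
qed

section \<open>Quadratic forms\<close>

text \<open>Both the loss and the exponents of the two Gaussian densities are instances of this
  form; in a density \<open>W\<close> is the inverse row covariance.\<close>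

definition trace_form :: "real mat \<Rightarrow> real mat \<Rightarrow> real mat \<Rightarrow> real" where
  "trace_form S W X = mat_trace (mat_inv S * transpose_mat X * W * X)"

lemma quadratic_loss_eq: "quadratic_loss W S Par \<Phi> = trace_form S W (Par - \<Phi>)"
  by (simp add: quadratic_loss_def trace_form_def)

lemma mat_mult_entry:
  assumes "U \<in> carrier_mat m r" "V \<in> carrier_mat r q" "i < m" "j < q"
  shows "(U * V) $$ (i, j) = (\<Sum>l<r. U $$ (i, l) * V $$ (l, j))"
  using assms by (auto simp: scalar_prod_def atLeast0LessThan)

text \<open>Exhibits the form as a linear combination of products of two entries of
  \<open>X\<close>, so that scaling and the parallelogram law reduce to real algebra in each
  summand.\<close>

lemma trace_form_sum:
  assumes S: "S \<in> carrier_mat p p" and W: "W \<in> carrier_mat k k" and X: "X \<in> carrier_mat k p"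
  shows "trace_form S W X = (\<Sum>a<p. \<Sum>j<k. \<Sum>i<k. \<Sum>b<p.
    mat_inv S $$ (a, b) * W $$ (i, j) * (X $$ (i, b) * X $$ (j, a)))"
proof -
  have Si: "mat_inv S \<in> carrier_mat p p" using S by simp
  have XS: "mat_inv S * transpose_mat X \<in> carrier_mat p k" using Si X by simp
  have XSW: "mat_inv S * transpose_mat X * W \<in> carrier_mat p k" using XS W by simp
  have "mat_trace (mat_inv S * transpose_mat X * W * X)
      = (\<Sum>a<p. (mat_inv S * transpose_mat X * W * X) $$ (a, a))"
    using Si by (simp add: mat_trace_def)
  also have "\<dots> = (\<Sum>a<p. \<Sum>j<k. (\<Sum>i<k. (\<Sum>b<p. mat_inv S $$ (a, b) * X $$ (i, b)) * W $$ (i, j))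
          * X $$ (j, a))"
  proof (intro sum.cong refl)
    fix a assume "a \<in> {..<p}"
    then have a: "a < p" by simp
    have "(mat_inv S * transpose_mat X) $$ (a, i) = (\<Sum>b<p. mat_inv S $$ (a, b) * X $$ (i, b))"
      if "i < k" for i
      using mat_mult_entry[OF Si _ a that, of "transpose_mat X"] X that by simp
    then have "(mat_inv S * transpose_mat X * W) $$ (a, j)
        = (\<Sum>i<k. (\<Sum>b<p. mat_inv S $$ (a, b) * X $$ (i, b)) * W $$ (i, j))" if "j < k" for j
      unfolding mat_mult_entry[OF XS W a that] by (intro sum.cong) auto
    then show "(mat_inv S * transpose_mat X * W * X) $$ (a, a)
        = (\<Sum>j<k. (\<Sum>i<k. (\<Sum>b<p. mat_inv S $$ (a, b) * X $$ (i, b)) * W $$ (i, j)) * X $$ (j, a))"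
      unfolding mat_mult_entry[OF XSW X a a] by (intro sum.cong) auto
  qed
  also have "\<dots> = (\<Sum>a<p. \<Sum>j<k. \<Sum>i<k. \<Sum>b<p.
      mat_inv S $$ (a, b) * W $$ (i, j) * (X $$ (i, b) * X $$ (j, a)))"
    by (simp add: sum_distrib_left sum_distrib_right mult_ac)
  finally show ?thesis by (simp add: trace_form_def)
qed

lemma trace_form_smult:
  assumes "S \<in> carrier_mat p p" "W \<in> carrier_mat k k" "X \<in> carrier_mat k p"
  shows "trace_form S W (c \<cdot>\<^sub>m X) = c\<^sup>2 * trace_form S W X"
  using assms trace_form_sum[of S p W k X] trace_form_sum[of S p W k "c \<cdot>\<^sub>m X"]
  by (simp add: sum_distrib_left power2_eq_square algebra_simps)

text \<open>With u = X - Mn and v = Mn - \<Phi>, the two arguments on the left are v + u and v - u,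
  since reflecting X about Mn changes the sign of u.\<close>

lemma trace_form_parallelogram:
  assumes S: "S \<in> carrier_mat p p" and W: "W \<in> carrier_mat k k"
    and c: "X \<in> carrier_mat k p" "Mn \<in> carrier_mat k p" "\<Phi> \<in> carrier_mat k p"
  shows "trace_form S W (X - \<Phi>) + trace_form S W ((2 \<cdot>\<^sub>m Mn + (-1) \<cdot>\<^sub>m X) - \<Phi>)
    = 2 * trace_form S W (X - Mn) + 2 * trace_form S W (Mn - \<Phi>)"
proof -
  \<comment> \<open>Polarised version for two different entries: the mixed products of u and v occur
    with opposite signs in the two terms and cancel. The factor \<open>s\<close> stands for the
    coefficient taken from the inverse of S and from W.\<close>
  have "\<And>s x x' m m' f f' :: real.
      s * ((x - f) * (x' - f')) + s * ((2 * m - x - f) * (2 * m' - x' - f'))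
        = 2 * (s * ((x - m) * (x' - m'))) + 2 * (s * ((m - f) * (m' - f')))"
    by (simp add: algebra_simps)
  note alg = this
  have car: "X - \<Phi> \<in> carrier_mat k p" "2 \<cdot>\<^sub>m Mn + (-1) \<cdot>\<^sub>m X - \<Phi> \<in> carrier_mat k p"
      "X - Mn \<in> carrier_mat k p" "Mn - \<Phi> \<in> carrier_mat k p"
    using c by (auto intro!: minus_carrier_mat)
  have e: "(X - \<Phi>) $$ (i, j) = X $$ (i, j) - \<Phi> $$ (i, j)"
      "(2 \<cdot>\<^sub>m Mn + (-1) \<cdot>\<^sub>m X - \<Phi>) $$ (i, j) = 2 * Mn $$ (i, j) - X $$ (i, j) - \<Phi> $$ (i, j)"
      "(X - Mn) $$ (i, j) = X $$ (i, j) - Mn $$ (i, j)"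
      "(Mn - \<Phi>) $$ (i, j) = Mn $$ (i, j) - \<Phi> $$ (i, j)" if "i < k" "j < p" for i j
    using c that by auto
  show ?thesis
    unfolding car[THEN trace_form_sum[OF S W]] sum_distrib_left sum.distrib[symmetric]
    by (intro sum.cong refl) (simp only: e lessThan_iff alg)
qed

text \<open>Moves a linear change of the argument into the weight. It links the loss for B to the
  loss for Theta and lets a weight be replaced by a diagonal one.\<close>

lemma trace_form_mult:
  assumes "S \<in> carrier_mat p p" "R \<in> carrier_mat l k" "W \<in> carrier_mat l l" "X \<in> carrier_mat k p"
  shows "trace_form S W (R * X) = trace_form S (transpose_mat R * W * R) X"
proof -
  have Si: "mat_inv S \<in> carrier_mat p p" using assms by simp
  let ?U = "mat_inv S * transpose_mat X"
  have Rt: "transpose_mat R \<in> carrier_mat k l" using assms by simp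
  have U: "?U \<in> carrier_mat p k" by (rule mult_carrier_mat[OF Si]) (use assms in simp)
  have UR: "?U * transpose_mat R \<in> carrier_mat p l" by (rule mult_carrier_mat[OF U Rt])
  have RW: "transpose_mat R * W \<in> carrier_mat k l" by (rule mult_carrier_mat[OF Rt]) fact
  have "mat_inv S * transpose_mat (R * X) = ?U * transpose_mat R"
    using assms Si Rt by (simp add: transpose_mult[of _ l k] assoc_mult_mat[of _ p p _ k _ l])
  then have "mat_inv S * transpose_mat (R * X) * W * (R * X) = ?U * transpose_mat R * W * (R * X)"
    by simp
  also have "\<dots> = ?U * transpose_mat R * W * R * X"
    by (rule assoc_mult_mat[symmetric, OF mult_carrier_mat[OF UR]]) fact+
  also have "?U * transpose_mat R * W = ?U * (transpose_mat R * W)"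
    by (rule assoc_mult_mat[OF U Rt]) fact
  also have "?U * (transpose_mat R * W) * R = ?U * (transpose_mat R * W * R)"
    by (rule assoc_mult_mat[OF U RW]) fact
  finally show ?thesis by (simp add: trace_form_def)
qed

section \<open>Positive definiteness and diagonal weights\<close>

lemma pos_def_mat_det:
  assumes "pos_def_mat p S"
  shows "Determinant.det S \<noteq> 0"
proof
  assume "Determinant.det S = 0"
  then obtain v where v: "v \<in> carrier_vec p" "v \<noteq> 0\<^sub>v p" "S *\<^sub>v v = 0\<^sub>v p"
    using assms det_0_iff_vec_prod_zero[of S p] by (auto simp: pos_def_mat_def)
  then have "scalar_prod v (S *\<^sub>v v) = 0" by simp
  with v assms show False by (auto simp: pos_def_mat_def)
qed

text \<open>Substituting x = S u turns the form of the inverse at x into the form of S at u, and u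
  is nonzero whenever x is.\<close>

lemma pos_def_mat_inv_form:
  assumes S: "pos_def_mat p S" and x: "x \<in> carrier_vec p"
  shows "x \<noteq> 0\<^sub>v p \<Longrightarrow> scalar_prod x (mat_inv S *\<^sub>v x) > 0"
    and "scalar_prod x (mat_inv S *\<^sub>v x) \<ge> 0"
proof -
  have Sc: "S \<in> carrier_mat p p"
    using S by (simp add: pos_def_mat_def)
  have Si: "mat_inv S \<in> carrier_mat p p" using Sc by simp
  define u where "u = mat_inv S *\<^sub>v x"
  have u: "u \<in> carrier_vec p" using Si x by (simp add: u_def)
  have "S *\<^sub>v u = (S * mat_inv S) *\<^sub>v x"
    using Sc Si x unfolding u_def by (simp add: assoc_mult_mat_vec[of _ p p _ p])
  then have Su: "S *\<^sub>v u = x"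
    using mat_inv_mult(1)[OF Sc pos_def_mat_det[OF S]] x by simp
  have eq: "scalar_prod x u = scalar_prod u (S *\<^sub>v u)"
    using Su x u by (simp add: comm_scalar_prod[of x p u])
  show pos: "scalar_prod x (mat_inv S *\<^sub>v x) > 0" if "x \<noteq> 0\<^sub>v p"
  proof -
    have "u \<noteq> 0\<^sub>v p" using that Su Sc by auto
    then show ?thesis using S u eq by (auto simp: pos_def_mat_def u_def)
  qed
  show "scalar_prod x (mat_inv S *\<^sub>v x) \<ge> 0"
    using pos Si x by (cases "x = 0\<^sub>v p") auto
qed

text \<open>A diagonal weight decouples the rows, so that monotonicity, nonnegativity and
  definiteness can each be read off from the inverse of S acting on single rows.\<close>

lemma trace_form_diag:
  assumes S: "S \<in> carrier_mat p p" and X: "X \<in> carrier_mat k p"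
  shows "trace_form S (mat_diag k w) X
    = (\<Sum>i<k. w i * scalar_prod (row X i) (mat_inv S *\<^sub>v row X i))"
proof -
  have Si: "mat_inv S \<in> carrier_mat p p" using S by simp
  have "trace_form S (mat_diag k w) X = (\<Sum>a<p. \<Sum>j<k. \<Sum>i<k. if i = j then
      (\<Sum>b<p. mat_inv S $$ (a, b) * w j * (X $$ (j, b) * X $$ (j, a))) else 0)"
    unfolding trace_form_sum[OF S mat_diag_dim X]
    by (intro sum.cong refl) (auto simp: mat_diag_def)
  also have "\<dots> = (\<Sum>a<p. \<Sum>j<k. \<Sum>b<p. mat_inv S $$ (a, b) * w j * (X $$ (j, b) * X $$ (j, a)))"
    by (simp add: sum.delta)
  also have "\<dots> = (\<Sum>j<k. \<Sum>a<p. \<Sum>b<p. mat_inv S $$ (a, b) * w j * (X $$ (j, b) * X $$ (j, a)))"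
    by (rule sum.swap)
  also have "\<dots> = (\<Sum>i<k. w i * scalar_prod (row X i) (mat_inv S *\<^sub>v row X i))"
    using Si X by (intro sum.cong refl)
      (auto simp: scalar_prod_def sum_distrib_left atLeast0LessThan mult_ac)
  finally show ?thesis .
qed

lemma trace_form_diag_mono:
  assumes S: "pos_def_mat p S" and X: "X \<in> carrier_mat k p"
    and le: "\<And>i. i < k \<Longrightarrow> v i \<le> w i"
  shows "trace_form S (mat_diag k v) X \<le> trace_form S (mat_diag k w) X"
proof -
  have "S \<in> carrier_mat p p"
    using S by (simp add: pos_def_mat_def)
  then show ?thesis
    using le X pos_def_mat_inv_form(2)[OF S]
    by (simp add: trace_form_diag) (intro sum_mono mult_right_mono, auto)
qed

lemma trace_form_diag_nonneg:
  assumes S: "pos_def_mat p S" and X: "X \<in> carrier_mat k p" and w: "\<And>i. i < k \<Longrightarrow> w i \<ge> 0"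
  shows "trace_form S (mat_diag k w) X \<ge> 0"
proof -
  have "S \<in> carrier_mat p p"
    using S by (simp add: pos_def_mat_def)
  then show ?thesis
    using w X pos_def_mat_inv_form(2)[OF S] by (auto simp: trace_form_diag intro!: sum_nonneg)
qed

lemma trace_form_diag_eq_0:
  assumes S: "pos_def_mat p S" and X: "X \<in> carrier_mat k p" and w: "\<And>i. i < k \<Longrightarrow> w i > 0"
    and 0: "trace_form S (mat_diag k w) X = 0"
  shows "X = 0\<^sub>m k p"
proof -
  have Sc: "S \<in> carrier_mat p p"
    using S by (simp add: pos_def_mat_def)
  have nn: "w i * scalar_prod (row X i) (mat_inv S *\<^sub>v row X i) \<ge> 0" if "i < k" for i
    using w[OF that] X pos_def_mat_inv_form(2)[OF S, of "row X i"] by auto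
  have "\<forall>i\<in>{..<k}. w i * scalar_prod (row X i) (mat_inv S *\<^sub>v row X i) = 0"
    using 0 nn unfolding trace_form_diag[OF Sc X] by (subst (asm) sum_nonneg_eq_0_iff) auto
  then have row: "row X i = 0\<^sub>v p" if "i < k" for i
    using that w[OF that] X pos_def_mat_inv_form(1)[OF S, of "row X i"] by force
  show ?thesis
  proof (rule eq_matI)
    fix i j assume "i < dim_row (0\<^sub>m k p :: real mat)" "j < dim_col (0\<^sub>m k p :: real mat)"
    then have ij: "i < k" "j < p" by auto
    then have "X $$ (i, j) = Matrix.vec_index (row X i) j"
      using X by auto
    then show "X $$ (i, j) = 0\<^sub>m k p $$ (i, j)"
      using ij row by simp
  qed (use X in auto)
qed

section \<open>Completing the square\<close>

lemma mat_trace_add: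
  assumes "X \<in> carrier_mat p p" "Z \<in> carrier_mat p p"
  shows "mat_trace (X + Z) = mat_trace X + mat_trace Z"
  using assms by (simp add: mat_trace_def sum.distrib)

lemma diff_form_expand:
  fixes H :: "real mat"
  assumes H: "H \<in> carrier_mat l l" and U: "U \<in> carrier_mat l p" and V: "V \<in> carrier_mat l p"
  shows "transpose_mat (U - V) * H * (U - V)
    = (transpose_mat U * H * U - transpose_mat V * H * U)
      - (transpose_mat U * H * V - transpose_mat V * H * V)"
proof -
  have "transpose_mat (U - V) = transpose_mat U - transpose_mat V"
    using U V by (intro eq_matI) auto
  note t = this
  have Ut: "transpose_mat U \<in> carrier_mat p l" and Vt: "transpose_mat V \<in> carrier_mat p l"
    using U V by auto
  note UH = mult_carrier_mat[OF Ut H] and VH = mult_carrier_mat[OF Vt H]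
  show ?thesis
    unfolding t minus_mult_distrib_mat[OF Ut Vt H]
      mult_minus_distrib_mat[OF minus_carrier_mat[OF VH] U V]
      minus_mult_distrib_mat[OF UH VH U] minus_mult_distrib_mat[OF UH VH V] ..
qed

text \<open>The prior form plus the residual sum of squares of a linear regression with design Z.
  \<open>Mn\<close> solves the normal equations and \<open>H'\<close> is the posterior precision.
  The identity holds between matrices, before any multiplication by the inverse of Sigma, so its
  centre cannot depend on Sigma. The factors \<open>1\<^sub>m n\<close> keep the residual term in
  the shape of a form with identity weight.\<close>

lemma complete_square:
  fixes H :: "real mat"
  assumes H: "H \<in> carrier_mat k k" "transpose_mat H = H" and Z: "Z \<in> carrier_mat n k"
    and c: "X \<in> carrier_mat k p" "Mn \<in> carrier_mat k p" "y \<in> carrier_mat n p"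
    and normal: "(H + transpose_mat Z * Z) * Mn = transpose_mat Z * y"
  defines "H' \<equiv> H + transpose_mat Z * Z"
  shows "transpose_mat X * H * X + transpose_mat (y - Z * X) * 1\<^sub>m n * (y - Z * X)
    = transpose_mat (X - Mn) * H' * (X - Mn)
      + (transpose_mat y * 1\<^sub>m n * y - transpose_mat Mn * H' * Mn)"
proof -
  have H': "H' \<in> carrier_mat k k" using H Z by (simp add: H'_def)
  have H't: "transpose_mat H' = H'"
    using H Z by (simp add: H'_def transpose_add[of _ k k] transpose_mult[of _ k n])
  have ZX: "Z * X \<in> carrier_mat n p" using Z c by simp
  have ZXt: "transpose_mat (Z * X) = transpose_mat X * transpose_mat Z"
    using Z c by (simp add: transpose_mult[of _ n k])
  \<comment> \<open>The normal equations identify one cross term of the two expansions; transposing,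
    with \<open>H'\<close> symmetric, gives the other one.\<close>
  have 1: "transpose_mat X * H' * Mn = transpose_mat (Z * X) * 1\<^sub>m n * y"
    using normal H' Z c ZX unfolding H'_def[symmetric] ZXt
    by (simp add: assoc_mult_mat[of _ p k _ k _ p] assoc_mult_mat[of _ p k _ n _ p])
  have "transpose_mat (transpose_mat X * H' * Mn) = transpose_mat Mn * H' * X"
  proof -
    have Xt: "transpose_mat X \<in> carrier_mat p k" and Mt: "transpose_mat Mn \<in> carrier_mat p k"
      using c by auto
    have "transpose_mat (transpose_mat X * H' * Mn) = transpose_mat Mn * transpose_mat (transpose_mat X * H')"
      by (rule transpose_mult[OF mult_carrier_mat[OF Xt H'] c(2)])
    also have "transpose_mat (transpose_mat X * H') = H' * X"
      using transpose_mult[OF Xt H'] H't by simp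
    also have "transpose_mat Mn * (H' * X) = transpose_mat Mn * H' * X"
      by (rule assoc_mult_mat[OF Mt H' c(1), symmetric])
    finally show ?thesis .
  qed
  moreover have "transpose_mat (transpose_mat (Z * X) * 1\<^sub>m n * y) = transpose_mat y * 1\<^sub>m n * (Z * X)"
  proof -
    have "transpose_mat (Z * X) * 1\<^sub>m n = transpose_mat (Z * X)" "transpose_mat y * 1\<^sub>m n = transpose_mat y"
      using ZX c by (auto intro!: right_mult_one_mat)
    moreover have "transpose_mat (Z * X) \<in> carrier_mat p n"
      using ZX by simp
    ultimately show ?thesis
      using transpose_mult[of "transpose_mat (Z * X)" p n y p] c by simp
  qed
  ultimately have 2: "transpose_mat Mn * H' * X = transpose_mat y * 1\<^sub>m n * (Z * X)"
    using 1 by simp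
  \<comment> \<open>The terms quadratic in X agree by the definition of \<open>H'\<close>. What
    remains involves only y and \<open>Mn\<close>.\<close>
  have 3: "transpose_mat X * H' * X = transpose_mat X * H * X + transpose_mat (Z * X) * 1\<^sub>m n * (Z * X)"
  proof -
    have ZZ: "transpose_mat Z * Z \<in> carrier_mat k k" and XZ: "transpose_mat X * transpose_mat Z \<in> carrier_mat p n"
      using Z c by auto
    have "transpose_mat (Z * X) * 1\<^sub>m n * (Z * X) = transpose_mat X * transpose_mat Z * (Z * X)"
      unfolding ZXt right_mult_one_mat[OF XZ] ..
    also have "\<dots> = transpose_mat X * (transpose_mat Z * Z) * X"
      using assoc_mult_mat[OF XZ Z c(1)] Z c by (simp add: assoc_mult_mat[of _ p k _ n _ k])
    finally have *: "transpose_mat (Z * X) * 1\<^sub>m n * (Z * X)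
        = transpose_mat X * (transpose_mat Z * Z) * X" .
    have Xt: "transpose_mat X \<in> carrier_mat p k" using c by simp
    show ?thesis
      unfolding * H'_def mult_add_distrib_mat[OF Xt H(1) ZZ]
      using Xt H ZZ c by (intro add_mult_distrib_mat[of _ p k]) auto
  qed
  show ?thesis
    unfolding diff_form_expand[OF H' c(1,2)] diff_form_expand[OF one_carrier_mat c(3) ZX]
    unfolding 1 2 3
    using H H' Z c ZX by (intro eq_matI) auto
qed

text \<open>Applies the linear functional tr(S^-1 .) to the matrix identity. The last summand is
  constant in X and is never evaluated; only its constancy matters.\<close>

lemma trace_form_complete_square:
  assumes S: "S \<in> carrier_mat p p" and H: "H \<in> carrier_mat k k" "transpose_mat H = H"
    and Z: "Z \<in> carrier_mat n k"
    and c: "Mn \<in> carrier_mat k p" "y \<in> carrier_mat n p"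
    and normal: "(H + transpose_mat Z * Z) * Mn = transpose_mat Z * y"
    and X: "X \<in> carrier_mat k p"
  shows "trace_form S H X + trace_form S (1\<^sub>m n) (y - Z * X)
    = trace_form S (H + transpose_mat Z * Z) (X - Mn)
      + mat_trace (mat_inv S * (transpose_mat y * 1\<^sub>m n * y
          - transpose_mat Mn * (H + transpose_mat Z * Z) * Mn))"
proof -
  have Si: "mat_inv S \<in> carrier_mat p p" using S by simp
  \<comment> \<open>Reassociation that isolates the inverse of S as a left factor, so that the
    matrix identity can be substituted behind it.\<close>
  have tf: "trace_form S W V = mat_trace (mat_inv S * (transpose_mat V * W * V))"
    if "W \<in> carrier_mat l l" "V \<in> carrier_mat l p" for W V l
    using that Si unfolding trace_form_def
    by (simp add: assoc_mult_mat[of _ p p _ l _ p] assoc_mult_mat[of _ p p _ l _ l]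
        assoc_mult_mat[of _ p l _ l _ p])
  have ZX: "y - Z * X \<in> carrier_mat n p" using Z c X by (simp add: minus_carrier_mat)
  have H': "H + transpose_mat Z * Z \<in> carrier_mat k k" using H Z by simp
  have XM: "X - Mn \<in> carrier_mat k p" using c X by (simp add: minus_carrier_mat)
  have add: "mat_trace (mat_inv S * U) + mat_trace (mat_inv S * V) = mat_trace (mat_inv S * (U + V))"
    if "U \<in> carrier_mat p p" "V \<in> carrier_mat p p" for U V
    using that Si by (simp add: mult_add_distrib_mat[of _ p p] mat_trace_add[of _ p])
  have m: "transpose_mat y * 1\<^sub>m n * y
          - transpose_mat Mn * (H + transpose_mat Z * Z) * Mn \<in> carrier_mat p p"
    using c H' by (intro minus_carrier_mat) auto
  have q: "transpose_mat U * W * U \<in> carrier_mat p p"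
    if "U \<in> carrier_mat l p" "W \<in> carrier_mat l l" for U W :: "real mat" and l
    using that by simp
  show ?thesis
    unfolding tf[OF H(1) X] tf[OF one_carrier_mat ZX] tf[OF H' XM]
    unfolding add[OF q[OF X H(1)] q[OF ZX one_carrier_mat]] add[OF q[OF XM H'] m]
    by (subst complete_square[OF H Z X c normal]) (rule refl)
qed

text \<open>Reflection changes X - Mn into its negative; the completed square is even and the
  constant remainder is the same on both sides.\<close>

lemma trace_form_reflect:
  assumes S: "S \<in> carrier_mat p p" and H: "H \<in> carrier_mat k k" "transpose_mat H = H"
    and Z: "Z \<in> carrier_mat n k"
    and c: "Mn \<in> carrier_mat k p" "y \<in> carrier_mat n p"
    and normal: "(H + transpose_mat Z * Z) * Mn = transpose_mat Z * y"
    and X: "X \<in> carrier_mat k p"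
  defines "X' \<equiv> 2 \<cdot>\<^sub>m Mn + (-1) \<cdot>\<^sub>m X"
  shows "trace_form S H X' + trace_form S (1\<^sub>m n) (y - Z * X')
    = trace_form S H X + trace_form S (1\<^sub>m n) (y - Z * X)"
proof -
  have X': "X' \<in> carrier_mat k p" using c X by (simp add: X'_def)
  have XM: "X - Mn \<in> carrier_mat k p" using c X by (simp add: minus_carrier_mat)
  have "X' - Mn = (-1) \<cdot>\<^sub>m (X - Mn)"
    using c X by (intro eq_matI) (auto simp: X'_def)
  then have "trace_form S (H + transpose_mat Z * Z) (X' - Mn)
      = trace_form S (H + transpose_mat Z * Z) (X - Mn)"
    using trace_form_smult[OF S _ XM, of "H + transpose_mat Z * Z" "-1"] H Z by simp
  then show ?thesis
    using trace_form_complete_square[OF S H Z c normal X]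
      trace_form_complete_square[OF S H Z c normal X'] by simp
qed

section \<open>Measurability of the matrix normal density\<close>

lemma mat_meas_trace_form[mat_meas]:
  assumes S: "S \<in> N \<rightarrow>\<^sub>M mat_lebesgue p p" and W: "W \<in> carrier_mat k k"
    and X: "X \<in> N \<rightarrow>\<^sub>M mat_lebesgue k p"
  shows "(\<lambda>x. trace_form (S x) W (X x)) \<in> borel_measurable N"
  unfolding trace_form_def
  by (rule mat_meas_trace mat_meas_mult mat_meas_inv mat_meas_transpose mat_meas_const S X W)+

lemma matrix_normal_density_eq:
  "matrix_normal_density m q Mu S Psi X = (2 * pi) powr (- (real m * real q) / 2)
    * Determinant.det S powr (- real m / 2) * Determinant.det Psi powr (- real q / 2)
    * exp (- (1 / 2) * trace_form S (mat_inv Psi) (X - Mu))"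
  by (simp add: matrix_normal_density_def trace_form_def)

lemma matrix_normal_density_nonneg: "matrix_normal_density m q Mu S Psi X \<ge> 0"
  by (simp add: matrix_normal_density_eq)

lemma mat_meas_matrix_normal_density[mat_meas]:
  assumes Mu: "Mu \<in> N \<rightarrow>\<^sub>M mat_lebesgue m q" and S: "S \<in> N \<rightarrow>\<^sub>M mat_lebesgue q q"
    and Psi: "Psi \<in> carrier_mat m m" and X: "X \<in> N \<rightarrow>\<^sub>M mat_lebesgue m q"
  shows "(\<lambda>x. matrix_normal_density m q (Mu x) (S x) Psi (X x)) \<in> borel_measurable N"
proof -
  have [measurable]: "(\<lambda>x. trace_form (S x) (mat_inv Psi) (X x - Mu x)) \<in> borel_measurable N"
    using Psi by (intro mat_meas_trace_form[OF S _ mat_meas_diff[OF X Mu]]) simp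
  have [measurable]: "(\<lambda>x. Determinant.det (S x)) \<in> borel_measurable N"
    by (rule mat_meas_det[OF S])
  show ?thesis
    unfolding matrix_normal_density_eq by measurable
qed

section \<open>The Gaussian model\<close>

lemma mat_inv_mat_diag:
  assumes "\<And>i. i < k \<Longrightarrow> g i \<noteq> 0"
  shows "mat_inv (mat_diag k g) = mat_diag k (\<lambda>i. 1 / g i)"
proof (rule mat_inv_eqI)
  show "mat_diag k g * mat_diag k (\<lambda>i. 1 / g i) = 1\<^sub>m k"
    unfolding mat_diag_diag using assms by (intro eq_matI) (auto simp: mat_diag_def)
qed simp_all

lemma mat_inv_one[simp]: "mat_inv (1\<^sub>m n) = 1\<^sub>m n"
  by (rule mat_inv_eqI) auto

text \<open>With \<open>h\<close> the exponent of the density, \<open>h exp(-h/2) \<le> 4 exp(-h/4)\<close>, and \<open>h/4\<close> becomes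
  \<open>h/2\<close> after rescaling \<open>X\<close> by \<open>sqrt 2\<close>; the bound does not depend on \<open>S\<close>.\<close>
lemma nn_integral_matrix_normal_trace_form_le:
  assumes S: "pos_def_mat p S" and g: "\<And>i. i < k \<Longrightarrow> g i > 0"
    and w: "\<And>i. i < k \<Longrightarrow> w i \<le> \<kappa> / g i" and \<kappa>: "\<kappa> \<ge> 0"
  defines "f \<equiv> matrix_normal_density k p (0\<^sub>m k p) S (mat_diag k g)"
  shows "(\<integral>\<^sup>+X. ennreal (f X) * ennreal (trace_form S (mat_diag k w) X) \<partial>mat_lebesgue k p)
    \<le> ennreal (4 * \<kappa> * sqrt 2 ^ (k * p)) * (\<integral>\<^sup>+X. ennreal (f X) \<partial>mat_lebesgue k p)"
proof -
  have Sc: "S \<in> carrier_mat p p"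
    using S by (simp add: pos_def_mat_def)
  define h where "h = trace_form S (mat_diag k (\<lambda>i. 1 / g i))"
  define c where "c = (2 * pi) powr (- (real k * real p) / 2)
    * Determinant.det S powr (- real k / 2) * Determinant.det (mat_diag k g) powr (- real p / 2)"
  have c: "c \<ge> 0" by (simp add: c_def)
  have sub0: "X - 0\<^sub>m k p = X" if "X \<in> carrier_mat k p" for X :: "real mat"
    using that by (intro eq_matI) auto
  have inv: "mat_inv (mat_diag k g) = mat_diag k (\<lambda>i. 1 / g i)"
    using g by (intro mat_inv_mat_diag) force
  have f: "f X = c * exp (- (1 / 2) * h X)" if "X \<in> carrier_mat k p" for X
    unfolding f_def h_def c_def matrix_normal_density_eq inv by (simp add: sub0[OF that])
  have h0: "h X \<ge> 0" if "X \<in> carrier_mat k p" for X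
    using g unfolding h_def by (intro trace_form_diag_nonneg[OF S that]) (simp add: less_imp_le)
  \<comment> \<open>The hypothesis on \<open>w\<close> compares the loss weight with the prior
    precisions 1 / g i, so the loss is dominated row by row by \<kappa> times the exponent
    form.\<close>
  have wh: "trace_form S (mat_diag k w) X \<le> \<kappa> * h X" if X: "X \<in> carrier_mat k p" for X
  proof -
    have "trace_form S (mat_diag k w) X \<le> trace_form S (mat_diag k (\<lambda>i. \<kappa> / g i)) X"
      using w by (intro trace_form_diag_mono[OF S X])
    also have "\<dots> = \<kappa> * h X"
      unfolding h_def trace_form_diag[OF Sc X] by (simp add: sum_distrib_left)
    finally show ?thesis .
  qed
  have meas: "h \<in> borel_measurable (mat_lebesgue k p)"
    unfolding h_def using Sc
    by (intro mat_meas_trace_form[of _ _ p] mat_meas_const measurable_ident_sets) auto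
  have bound: "f X * trace_form S (mat_diag k w) X \<le> 4 * \<kappa> * (c * exp (- (1 / 4) * h X))"
    if X: "X \<in> carrier_mat k p" for X
  proof -
    \<comment> \<open>The inequality t \<le> exp t at t = h/4. Half of the exponential decay absorbs
      the factor h, at the cost of the constant 4; the other half remains integrable.\<close>
    have "h X / 4 \<le> exp (h X / 4)"
      using exp_ge_add_one_self[of "h X / 4"] by linarith
    then have "h X * exp (- (1 / 4) * h X) \<le> 4 * exp (h X / 4) * exp (- (1 / 4) * h X)"
      by (intro mult_right_mono) auto
    also have "\<dots> = 4" by (simp flip: exp_add)
    finally have 4: "h X * exp (- (1 / 4) * h X) \<le> 4" .
    have "exp (- (1 / 2) * h X) = exp (- (1 / 4) * h X) * exp (- (1 / 4) * h X)"
      by (simp flip: exp_add)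
    then have "f X * trace_form S (mat_diag k w) X
        \<le> c * (exp (- (1 / 4) * h X) * exp (- (1 / 4) * h X)) * (\<kappa> * h X)"
      using f[OF X] wh[OF X] c by (simp add: mult_left_mono)
    also have "\<dots> = \<kappa> * (c * exp (- (1 / 4) * h X)) * (h X * exp (- (1 / 4) * h X))"
      by simp
    also have "\<dots> \<le> \<kappa> * (c * exp (- (1 / 4) * h X)) * 4"
      using c \<kappa> 4 by (intro mult_left_mono) auto
    finally show ?thesis by simp
  qed
  have scale: "h (0\<^sub>m k p + sqrt 2 \<cdot>\<^sub>m X) = 2 * h X" if X: "X \<in> carrier_mat k p" for X
    using X trace_form_smult[OF Sc _ X, of "mat_diag k (\<lambda>i. 1 / g i)" "sqrt 2"] by (simp add: h_def)
  have "(\<integral>\<^sup>+X. ennreal (f X) * ennreal (trace_form S (mat_diag k w) X) \<partial>mat_lebesgue k p)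
      \<le> (\<integral>\<^sup>+X. ennreal (4 * \<kappa>) * ennreal (c * exp (- (1 / 4) * h X)) \<partial>mat_lebesgue k p)"
    using bound \<kappa> by (intro nn_integral_mono)
      (auto simp: space_mat_lebesgue f c simp flip: ennreal_mult' intro!: ennreal_leI)
  also have "\<dots> = ennreal (4 * \<kappa>) * (\<integral>\<^sup>+X. ennreal (c * exp (- (1 / 4) * h X)) \<partial>mat_lebesgue k p)"
    using meas by (intro nn_integral_cmult) measurable
  also have "(\<integral>\<^sup>+X. ennreal (c * exp (- (1 / 4) * h X)) \<partial>mat_lebesgue k p)
      = ennreal (\<bar>sqrt 2\<bar> ^ (k * p)) * (\<integral>\<^sup>+X. ennreal (c * exp (- (1 / 4) * h (0\<^sub>m k p + sqrt 2 \<cdot>\<^sub>m X))) \<partial>mat_lebesgue k p)"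
    using meas by (intro nn_integral_mat_lebesgue_affine) auto
  also have "(\<integral>\<^sup>+X. ennreal (c * exp (- (1 / 4) * h (0\<^sub>m k p + sqrt 2 \<cdot>\<^sub>m X))) \<partial>mat_lebesgue k p)
      = (\<integral>\<^sup>+X. ennreal (f X) \<partial>mat_lebesgue k p)"
  proof (rule nn_integral_cong)
    fix X assume "X \<in> space (mat_lebesgue k p)"
    then have X: "X \<in> carrier_mat k p" by (simp add: space_mat_lebesgue)
    show "ennreal (c * exp (- (1 / 4) * h (0\<^sub>m k p + sqrt 2 \<cdot>\<^sub>m X))) = ennreal (f X)"
      unfolding scale[OF X] f[OF X] by simp
  qed
  finally show ?thesis
    using \<kappa> by (simp add: ennreal_mult' mult.assoc)
qed

text \<open>Disintegrates twice: first Y given (B, Sigma), then Theta given Sigma. The model is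
  stated in terms of B and the prior in terms of Theta = Q B, so the test function is rewritten
  through Q for the first stage and B is recovered as P Theta for the second. The integral over x
  ends up innermost, so that a change of variables in x may depend on y. Sigma remains a random
  variable on M, since only its law is given.\<close>

lemma nn_integral_gaussian_joint:
  assumes M: "finite_measure M"
    and prior: "has_cond_distr M (mat_lebesgue k p) Theta (mat_lebesgue p p) Sig
        (\<lambda>S. matrix_normal k p (0\<^sub>m k p) S G)"
    and model: "has_cond_distr M (mat_lebesgue n p) Y (mat_lebesgue k p \<Otimes>\<^sub>M mat_lebesgue p p)
        (\<lambda>\<omega>. (B \<omega>, Sig \<omega>)) (\<lambda>(b, S). matrix_normal n p (A * b) S (1\<^sub>m n))"
    and A: "A \<in> carrier_mat n k" and G: "G \<in> carrier_mat k k"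
    and P: "P \<in> carrier_mat k k" "Q \<in> carrier_mat k k" "P * Q = 1\<^sub>m k"
    and Theta: "Theta = (\<lambda>\<omega>. Q * B \<omega>)"
    and h: "h \<in> borel_measurable (mat_lebesgue n p \<Otimes>\<^sub>M (mat_lebesgue k p \<Otimes>\<^sub>M mat_lebesgue p p))"
  shows "(\<integral>\<^sup>+\<omega>. h (Y \<omega>, (Theta \<omega>, Sig \<omega>)) \<partial>M) = (\<integral>\<^sup>+\<omega>. (\<integral>\<^sup>+y. (\<integral>\<^sup>+x.
      ennreal (matrix_normal_density k p (0\<^sub>m k p) (Sig \<omega>) G x
          * matrix_normal_density n p (A * (P * x)) (Sig \<omega>) (1\<^sub>m n) y)
        * h (y, (x, Sig \<omega>)) \<partial>mat_lebesgue k p) \<partial>mat_lebesgue n p) \<partial>M)"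
proof -
  let ?Ln = "mat_lebesgue n p" and ?Lk = "mat_lebesgue k p" and ?Lp = "mat_lebesgue p p"
  have Y: "Y \<in> M \<rightarrow>\<^sub>M ?Ln" and BS: "(\<lambda>\<omega>. (B \<omega>, Sig \<omega>)) \<in> M \<rightarrow>\<^sub>M ?Lk \<Otimes>\<^sub>M ?Lp"
    and Theta_meas: "Theta \<in> M \<rightarrow>\<^sub>M ?Lk" and Sig: "Sig \<in> M \<rightarrow>\<^sub>M ?Lp"
    using model prior by (auto simp: has_cond_distr_def)
  have B: "B \<in> M \<rightarrow>\<^sub>M ?Lk"
    using measurable_compose[OF BS measurable_fst] by simp
  let ?f = "\<lambda>S x. ennreal (matrix_normal_density k p (0\<^sub>m k p) S G x)"
  let ?g = "\<lambda>b S y. ennreal (matrix_normal_density n p (A * b) S (1\<^sub>m n) y)"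
  \<comment> \<open>The test function after the observation has been integrated out at fixed Theta =
    x and Sigma = S; it serves as test function for the prior stage.\<close>
  define u where "u = (\<lambda>(x, S). \<integral>\<^sup>+y. ?g (P * x) S y * h (y, (x, S)) \<partial>?Ln)"
  have f_meas: "(\<lambda>x. ?f (s x) (t x)) \<in> borel_measurable N"
    if "s \<in> N \<rightarrow>\<^sub>M ?Lp" "t \<in> N \<rightarrow>\<^sub>M ?Lk" for s t and N :: "'c measure"
    using that G by (intro measurable_compose[OF _ measurable_ennreal]
        mat_meas_matrix_normal_density mat_meas_const) auto
  have g_meas: "(\<lambda>x. ?g (b x) (s x) (y x)) \<in> borel_measurable N"
    if "b \<in> N \<rightarrow>\<^sub>M ?Lk" "s \<in> N \<rightarrow>\<^sub>M ?Lp" "y \<in> N \<rightarrow>\<^sub>M ?Ln" for b s y and N :: "'c measure"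
    using that A by (intro measurable_compose[OF _ measurable_ennreal]
        mat_meas_matrix_normal_density mat_meas_mult[of _ _ n k] mat_meas_const) auto
  note [measurable] = h
  have Qb[measurable]: "(\<lambda>b. Q * b) \<in> ?Lk \<rightarrow>\<^sub>M ?Lk" and Px[measurable]: "(\<lambda>b. P * b) \<in> ?Lk \<rightarrow>\<^sub>M ?Lk"
    using P by (auto intro!: mat_meas_mult[of _ _ k k] mat_meas_const measurable_ident_sets)
  have fm1[measurable]: "(\<lambda>(x, S). ?f S x) \<in> borel_measurable (?Lk \<Otimes>\<^sub>M ?Lp)"
    unfolding case_prod_beta by (intro f_meas) auto
  have gm1[measurable]: "(\<lambda>(y, z). ?g (fst z) (snd z) y) \<in> borel_measurable (?Ln \<Otimes>\<^sub>M (?Lk \<Otimes>\<^sub>M ?Lp))"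
    unfolding case_prod_beta by (intro g_meas) auto
  have h1: "(\<lambda>(y, (b, S)). h (y, (Q * b, S))) \<in> borel_measurable (?Ln \<Otimes>\<^sub>M (?Lk \<Otimes>\<^sub>M ?Lp))"
    by measurable
  have u_meas: "u \<in> borel_measurable (?Lk \<Otimes>\<^sub>M ?Lp)"
    unfolding u_def case_prod_beta
  proof (rule sigma_finite_measure.borel_measurable_nn_integral[OF sigma_finite_mat_lebesgue])
    have "(\<lambda>zy. ?g (P * fst (fst zy)) (snd (fst zy)) (snd zy)) \<in> borel_measurable ((?Lk \<Otimes>\<^sub>M ?Lp) \<Otimes>\<^sub>M ?Ln)"
      by (intro g_meas measurable_compose[OF _ Px]) auto
    moreover have "(\<lambda>zy. h (snd zy, (fst (fst zy), snd (fst zy)))) \<in> borel_measurable ((?Lk \<Otimes>\<^sub>M ?Lp) \<Otimes>\<^sub>M ?Ln)"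
      by measurable
    ultimately show "(\<lambda>(z, y). ?g (P * fst z) (snd z) y * h (y, (fst z, snd z)))
        \<in> borel_measurable ((?Lk \<Otimes>\<^sub>M ?Lp) \<Otimes>\<^sub>M ?Ln)"
      unfolding case_prod_beta by (rule borel_measurable_times_ennreal)
  qed
  have "(\<integral>\<^sup>+\<omega>. h (Y \<omega>, (Theta \<omega>, Sig \<omega>)) \<partial>M)
      = (\<integral>\<^sup>+\<omega>. (\<lambda>(y, (b, S)). h (y, (Q * b, S))) (Y \<omega>, (B \<omega>, Sig \<omega>)) \<partial>M)"
    by (simp add: Theta)
  also have "\<dots> = (\<integral>\<^sup>+\<omega>. (\<integral>\<^sup>+y. ?g (fst (B \<omega>, Sig \<omega>)) (snd (B \<omega>, Sig \<omega>)) y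
      * (\<lambda>(y, (b, S)). h (y, (Q * b, S))) (y, (B \<omega>, Sig \<omega>)) \<partial>?Ln) \<partial>M)"
    by (rule nn_integral_has_cond_distr_density[OF M model sigma_finite_mat_lebesgue _ gm1 h1])
      (auto simp: matrix_normal_def)
  also have "\<dots> = (\<integral>\<^sup>+\<omega>. u (Theta \<omega>, Sig \<omega>) \<partial>M)"
  proof (rule nn_integral_cong)
    fix \<omega> assume "\<omega> \<in> space M"
    then have "B \<omega> \<in> carrier_mat k p"
      by (rule measurable_mat_lebesgueD(1)[OF B])
    then have "P * Theta \<omega> = B \<omega>"
      using P by (simp add: Theta flip: assoc_mult_mat)
    then show "(\<integral>\<^sup>+y. ?g (fst (B \<omega>, Sig \<omega>)) (snd (B \<omega>, Sig \<omega>)) y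
        * (\<lambda>(y, (b, S)). h (y, (Q * b, S))) (y, (B \<omega>, Sig \<omega>)) \<partial>?Ln) = u (Theta \<omega>, Sig \<omega>)"
      by (simp add: u_def) (simp add: Theta)
  qed
  also have "\<dots> = (\<integral>\<^sup>+\<omega>. (\<integral>\<^sup>+x. ?f (Sig \<omega>) x * u (x, Sig \<omega>) \<partial>?Lk) \<partial>M)"
    by (rule nn_integral_has_cond_distr_density[OF M prior sigma_finite_mat_lebesgue _ fm1 u_meas])
      (auto simp: matrix_normal_def)
  also have "\<dots> = (\<integral>\<^sup>+\<omega>. (\<integral>\<^sup>+y. (\<integral>\<^sup>+x.
      ennreal (matrix_normal_density k p (0\<^sub>m k p) (Sig \<omega>) G x
          * matrix_normal_density n p (A * (P * x)) (Sig \<omega>) (1\<^sub>m n) y)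
        * h (y, (x, Sig \<omega>)) \<partial>?Lk) \<partial>?Ln) \<partial>M)"
  proof (rule nn_integral_cong)
    fix \<omega> assume "\<omega> \<in> space M"
    then have [measurable]: "Sig \<omega> \<in> space ?Lp"
      by (rule measurable_space[OF Sig])
    let ?S = "Sig \<omega>"
    interpret pair_sigma_finite ?Ln ?Lk
      by (simp add: pair_sigma_finite_def sigma_finite_mat_lebesgue)
    have gm: "(\<lambda>y. ?g (P * x) ?S y) \<in> borel_measurable ?Ln" if "x \<in> space ?Lk" for x
      using that measurable_space[OF Px that] \<open>?S \<in> space ?Lp\<close>
      by (intro g_meas measurable_const measurable_ident_sets) auto
    have hm: "(\<lambda>y. h (y, (x, ?S))) \<in> borel_measurable ?Ln" if "x \<in> space ?Lk" for x
      using that \<open>?S \<in> space ?Lp\<close>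
      by (intro measurable_compose[OF _ h] measurable_Pair measurable_const measurable_ident_sets) auto
    have "(\<integral>\<^sup>+x. ?f ?S x * u (x, ?S) \<partial>?Lk)
        = (\<integral>\<^sup>+x. (\<integral>\<^sup>+y. ?f ?S x * (?g (P * x) ?S y * h (y, (x, ?S))) \<partial>?Ln) \<partial>?Lk)"
    proof (rule nn_integral_cong)
      fix x assume x: "x \<in> space ?Lk"
      show "?f ?S x * u (x, ?S) = (\<integral>\<^sup>+y. ?f ?S x * (?g (P * x) ?S y * h (y, (x, ?S))) \<partial>?Ln)"
        unfolding u_def split
        by (rule nn_integral_cmult[symmetric]) (intro borel_measurable_times_ennreal gm hm x)
    qed
    also have "\<dots> = (\<integral>\<^sup>+y. (\<integral>\<^sup>+x. ?f ?S x * (?g (P * x) ?S y * h (y, (x, ?S))) \<partial>?Lk) \<partial>?Ln)"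
    proof (rule Fubini'[of "\<lambda>y x. ?f ?S x * (?g (P * x) ?S y * h (y, (x, ?S)))"])
      have "(\<lambda>yx. h (fst yx, (snd yx, ?S))) \<in> borel_measurable (?Ln \<Otimes>\<^sub>M ?Lk)"
        using \<open>?S \<in> space ?Lp\<close>
        by (intro measurable_compose[OF _ h] measurable_Pair measurable_const) auto
      then show "(\<lambda>(y, x). ?f ?S x * (?g (P * x) ?S y * h (y, (x, ?S)))) \<in> borel_measurable (?Ln \<Otimes>\<^sub>M ?Lk)"
        unfolding case_prod_beta using \<open>?S \<in> space ?Lp\<close>
        by (intro borel_measurable_times_ennreal f_meas g_meas measurable_compose[OF _ Px] measurable_const) auto
    qed
    finally show "(\<integral>\<^sup>+x. ?f ?S x * u (x, ?S) \<partial>?Lk) = (\<integral>\<^sup>+y. (\<integral>\<^sup>+x.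
      ennreal (matrix_normal_density k p (0\<^sub>m k p) ?S G x
          * matrix_normal_density n p (A * (P * x)) ?S (1\<^sub>m n) y)
        * h (y, (x, ?S)) \<partial>?Lk) \<partial>?Ln)"
      by (simp add: ennreal_mult matrix_normal_density_nonneg mult.assoc)
  qed
  finally show ?thesis .
qed

text \<open>Completing the square shows that the joint density is invariant under
  \<open>x \<mapsto> 2 Mn(y) - x\<close>, and so is Lebesgue measure; no normalising constant is needed.\<close>
lemma gaussian_posterior_reflection:
  assumes M: "finite_measure M"
    and prior: "has_cond_distr M (mat_lebesgue k p) Theta (mat_lebesgue p p) Sig
        (\<lambda>S. matrix_normal k p (0\<^sub>m k p) S G)"
    and model: "has_cond_distr M (mat_lebesgue n p) Y (mat_lebesgue k p \<Otimes>\<^sub>M mat_lebesgue p p)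
        (\<lambda>\<omega>. (B \<omega>, Sig \<omega>)) (\<lambda>(b, S). matrix_normal n p (A * b) S (1\<^sub>m n))"
    and A: "A \<in> carrier_mat n k" and G: "G \<in> carrier_mat k k" "transpose_mat (mat_inv G) = mat_inv G"
    and P: "P \<in> carrier_mat k k" "Q \<in> carrier_mat k k" "P * Q = 1\<^sub>m k"
    and Theta: "Theta = (\<lambda>\<omega>. Q * B \<omega>)"
    and Mn: "Mn \<in> mat_lebesgue n p \<rightarrow>\<^sub>M mat_lebesgue k p"
    and normal: "\<forall>y\<in>carrier_mat n p.
      (mat_inv G + transpose_mat (A * P) * (A * P)) * Mn y = transpose_mat (A * P) * y"
    and h: "h \<in> borel_measurable (mat_lebesgue n p \<Otimes>\<^sub>M (mat_lebesgue k p \<Otimes>\<^sub>M mat_lebesgue p p))"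
  shows "(\<integral>\<^sup>+\<omega>. h (Y \<omega>, (Theta \<omega>, Sig \<omega>)) \<partial>M)
    = (\<integral>\<^sup>+\<omega>. h (Y \<omega>, (2 \<cdot>\<^sub>m Mn (Y \<omega>) + (-1) \<cdot>\<^sub>m Theta \<omega>, Sig \<omega>)) \<partial>M)"
proof -
  let ?Ln = "mat_lebesgue n p" and ?Lk = "mat_lebesgue k p" and ?Lp = "mat_lebesgue p p"
  let ?r = "\<lambda>y x. 2 \<cdot>\<^sub>m Mn y + (-1) \<cdot>\<^sub>m x"
  have Sig: "Sig \<in> M \<rightarrow>\<^sub>M ?Lp"
    using prior by (auto simp: has_cond_distr_def)
  \<comment> \<open>The reflection is written as Mu + c X to fit the affine change of variables with
    c = -1. Its measurability is obtained from the equal difference 2 Mn - x.\<close>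
  have r_meas: "(\<lambda>t. ?r (a t) (b t)) \<in> N \<rightarrow>\<^sub>M ?Lk"
    if a: "a \<in> N \<rightarrow>\<^sub>M ?Ln" and b: "b \<in> N \<rightarrow>\<^sub>M ?Lk" for a b and N :: "'c measure"
  proof -
    have aM: "(\<lambda>t. Mn (a t)) \<in> N \<rightarrow>\<^sub>M ?Lk"
      by (rule measurable_compose[OF a Mn])
    have "(\<lambda>t. 2 \<cdot>\<^sub>m Mn (a t) - b t) \<in> N \<rightarrow>\<^sub>M ?Lk"
      by (intro mat_meas_diff mat_meas_smult aM b) simp
    then show ?thesis
    proof (rule measurable_cong[THEN iffD1, rotated])
      fix t assume t: "t \<in> space N"
      show "2 \<cdot>\<^sub>m Mn (a t) - b t = ?r (a t) (b t)"
        using measurable_mat_lebesgueD(1)[OF aM t] measurable_mat_lebesgueD(1)[OF b t]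
        by (intro eq_matI) auto
    qed
  qed
  have h': "(\<lambda>z. h (fst z, (?r (fst z) (fst (snd z)), snd (snd z)))) \<in> borel_measurable (?Ln \<Otimes>\<^sub>M (?Lk \<Otimes>\<^sub>M ?Lp))"
    by (intro measurable_compose[OF _ h] measurable_Pair r_meas) auto
  let ?d = "\<lambda>S y x. ennreal (matrix_normal_density k p (0\<^sub>m k p) S G x
      * matrix_normal_density n p (A * (P * x)) S (1\<^sub>m n) y)"
  have inner: "(\<integral>\<^sup>+x. ?d S y x * h (y, (x, S)) \<partial>?Lk) = (\<integral>\<^sup>+x. ?d S y x * h (y, (?r y x, S)) \<partial>?Lk)"
    if S: "S \<in> carrier_mat p p" and y: "y \<in> carrier_mat n p" for S y
  proof -
    have My: "Mn y \<in> carrier_mat k p"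
      using measurable_space[OF Mn] y by (auto simp: space_mat_lebesgue)
    have "(\<lambda>x. ?d S y x) \<in> borel_measurable ?Lk"
    proof (intro measurable_compose[OF _ measurable_ennreal] borel_measurable_times
        mat_meas_matrix_normal_density)
      show "(\<lambda>x. A * (P * x)) \<in> ?Lk \<rightarrow>\<^sub>M ?Ln"
        using A P by (intro mat_meas_mult[of _ _ n k] mat_meas_mult[of _ _ k k] mat_meas_const
            measurable_ident_sets) auto
    qed (use S y G in \<open>auto intro!: mat_meas_const measurable_ident_sets\<close>)
    moreover have "(\<lambda>x. h (y, (x, S))) \<in> borel_measurable ?Lk"
      using S y by (intro measurable_compose[OF _ h] measurable_Pair measurable_const measurable_ident_sets)
        (auto simp: space_mat_lebesgue)
    ultimately have "(\<integral>\<^sup>+x. ?d S y x * h (y, (x, S)) \<partial>?Lk)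
        = ennreal (\<bar>-1\<bar> ^ (k * p)) * (\<integral>\<^sup>+x. ?d S y (?r y x) * h (y, (?r y x, S)) \<partial>?Lk)"
      using My by (intro nn_integral_mat_lebesgue_affine borel_measurable_times_ennreal) auto
    also have "\<dots> = (\<integral>\<^sup>+x. ?d S y (?r y x) * h (y, (?r y x, S)) \<partial>?Lk)"
      by simp
    also have "\<dots> = (\<integral>\<^sup>+x. ?d S y x * h (y, (?r y x, S)) \<partial>?Lk)"
    proof (rule nn_integral_cong)
      fix x assume "x \<in> space ?Lk"
      then have x: "x \<in> carrier_mat k p" by (simp add: space_mat_lebesgue)
      have rx: "?r y x \<in> carrier_mat k p" using x My by simp
      have sub0: "X - 0\<^sub>m k p = X" if "X \<in> carrier_mat k p" for X :: "real mat"
        using that by (intro eq_matI) auto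
      have AP: "A * (P * X) = A * P * X" if "X \<in> carrier_mat k p" for X
        using A P that by simp
      have "A * P \<in> carrier_mat n k" using A P by simp
      from trace_form_reflect[OF S _ G(2) this My y bspec[OF normal y] x]
      have eq: "trace_form S (mat_inv G) (?r y x) + trace_form S (1\<^sub>m n) (y - A * P * ?r y x)
          = trace_form S (mat_inv G) x + trace_form S (1\<^sub>m n) (y - A * P * x)"
        using G by simp
      \<comment> \<open>Neither density is invariant by itself: only the sum of the two exponents
        is. The factors in front of the exponentials do not contain x.\<close>
      have "exp (- (1 / 2) * trace_form S (mat_inv G) (?r y x)) * exp (- (1 / 2) * trace_form S (1\<^sub>m n) (y - A * P * ?r y x))
          = exp (- (1 / 2) * trace_form S (mat_inv G) x) * exp (- (1 / 2) * trace_form S (1\<^sub>m n) (y - A * P * x))"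
        using eq by (simp flip: exp_add add: field_simps)
      then have "matrix_normal_density k p (0\<^sub>m k p) S G (?r y x)
          * matrix_normal_density n p (A * (P * ?r y x)) S (1\<^sub>m n) y
        = matrix_normal_density k p (0\<^sub>m k p) S G x * matrix_normal_density n p (A * (P * x)) S (1\<^sub>m n) y"
        unfolding matrix_normal_density_eq sub0[OF x] sub0[OF rx] AP[OF x] AP[OF rx] mat_inv_one
        by (simp only: mult_ac)
      then show "?d S y (?r y x) * h (y, (?r y x, S)) = ?d S y x * h (y, (?r y x, S))"
        by simp
    qed
    finally show ?thesis .
  qed
  note joint = nn_integral_gaussian_joint[OF M prior model A G(1) P Theta]
  have "(\<integral>\<^sup>+\<omega>. h (Y \<omega>, (Theta \<omega>, Sig \<omega>)) \<partial>M)
      = (\<integral>\<^sup>+\<omega>. (\<integral>\<^sup>+y. (\<integral>\<^sup>+x. ?d (Sig \<omega>) y x * h (y, (x, Sig \<omega>)) \<partial>?Lk) \<partial>?Ln) \<partial>M)"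
    by (rule joint[OF h])
  also have "\<dots> = (\<integral>\<^sup>+\<omega>. (\<integral>\<^sup>+y. (\<integral>\<^sup>+x. ?d (Sig \<omega>) y x * h (y, (?r y x, Sig \<omega>)) \<partial>?Lk) \<partial>?Ln) \<partial>M)"
    using measurable_mat_lebesgueD(1)[OF Sig]
    by (intro nn_integral_cong inner) (auto simp: space_mat_lebesgue)
  also have "\<dots> = (\<integral>\<^sup>+\<omega>. h (Y \<omega>, (?r (Y \<omega>) (Theta \<omega>), Sig \<omega>)) \<partial>M)"
    using joint[OF h'] by simp
  finally show ?thesis .
qed

text \<open>Weights of the form R^T diag(w) R cover both losses at once: R is the identity for
  Theta, and the transpose of P for B.\<close>

lemma trace_form_nonneg:
  assumes S: "pos_def_mat p S" and R: "R \<in> carrier_mat k k" and X: "X \<in> carrier_mat k p"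
    and w: "\<And>i. i < k \<Longrightarrow> w i > 0" and W: "W = transpose_mat R * mat_diag k w * R"
  shows "trace_form S W X \<ge> 0"
proof -
  have Sc: "S \<in> carrier_mat p p"
    using S by (simp add: pos_def_mat_def)
  have "trace_form S (mat_diag k w) (R * X) \<ge> 0"
    using R X w by (intro trace_form_diag_nonneg[OF S]) (auto simp: less_imp_le)
  then show ?thesis
    using trace_form_mult[OF Sc R mat_diag_dim X, of w] W by simp
qed

lemma trace_form_eq_0:
  assumes S: "pos_def_mat p S" and R: "R \<in> carrier_mat k k" and X: "X \<in> carrier_mat k p"
    and w: "\<And>i. i < k \<Longrightarrow> w i > 0" and W: "W = transpose_mat R * mat_diag k w * R"
    and Q: "Q \<in> carrier_mat k k" "Q * R = 1\<^sub>m k" and 0: "trace_form S W X = 0"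
  shows "X = 0\<^sub>m k p"
proof -
  have Sc: "S \<in> carrier_mat p p"
    using S by (simp add: pos_def_mat_def)
  have RX: "R * X \<in> carrier_mat k p" using R X by simp
  have "trace_form S (mat_diag k w) (R * X) = 0"
    using trace_form_mult[OF Sc R mat_diag_dim X, of w] W 0 by simp
  then have "R * X = 0\<^sub>m k p"
    using w by (intro trace_form_diag_eq_0[OF S RX]) auto
  then have "Q * R * X = 0\<^sub>m k p"
    unfolding assoc_mult_mat[OF Q(1) R X] using Q by simp
  then show ?thesis unfolding Q(2) using X by simp
qed

text \<open>The embedding \<open>ennreal\<close> truncates negative numbers to zero, so the
  parallelogram law passes to extended reals only once all four terms are known to be
  nonnegative.\<close>

lemma ennreal_add_eq_double:
  assumes "a + b = 2 * c + 2 * e" "a \<ge> 0" "b \<ge> 0" "c \<ge> 0" "e \<ge> 0"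
  shows "ennreal a + ennreal b = 2 * (ennreal c + ennreal e)"
proof -
  have "ennreal a + ennreal b = ennreal (2 * (c + e))"
    using assms by (simp flip: ennreal_plus add: distrib_left)
  also have "\<dots> = ennreal 2 * ennreal (c + e)"
    by (rule ennreal_mult') simp
  finally show ?thesis using assms by simp
qed

text \<open>Averaging the loss over the reflection and using the parallelogram law splits it into the
  loss of \<open>Mn\<close> and the excess loss demanded by \<open>is_the_bayes_estimatorI\<close>.\<close>
lemma is_the_bayes_estimator_of_reflection:
  assumes M: "finite_measure M" and Y: "Y \<in> M \<rightarrow>\<^sub>M mat_lebesgue n p"
    and Par: "Par \<in> M \<rightarrow>\<^sub>M mat_lebesgue k p" and Sig: "Sig \<in> M \<rightarrow>\<^sub>M mat_lebesgue p p"
    and pos: "AE \<omega> in M. pos_def_mat p (Sig \<omega>)"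
    and Mn: "Mn \<in> mat_lebesgue n p \<rightarrow>\<^sub>M mat_lebesgue k p"
    and refl: "\<And>h. h \<in> borel_measurable (mat_lebesgue n p \<Otimes>\<^sub>M (mat_lebesgue k p \<Otimes>\<^sub>M mat_lebesgue p p)) \<Longrightarrow>
      (\<integral>\<^sup>+\<omega>. h (Y \<omega>, (Par \<omega>, Sig \<omega>)) \<partial>M)
        = (\<integral>\<^sup>+\<omega>. h (Y \<omega>, (2 \<cdot>\<^sub>m Mn (Y \<omega>) + (-1) \<cdot>\<^sub>m Par \<omega>, Sig \<omega>)) \<partial>M)"
    and R: "R \<in> carrier_mat k k" "Q \<in> carrier_mat k k" "Q * R = 1\<^sub>m k"
    and w: "\<And>i. i < k \<Longrightarrow> w i > 0" and W: "W = transpose_mat R * mat_diag k w * R"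
    and fin: "(\<integral>\<^sup>+\<omega>. ennreal (trace_form (Sig \<omega>) W (Par \<omega>)) \<partial>M) < \<infinity>"
    and T: "T \<in> mat_lebesgue n p \<rightarrow>\<^sub>M N" and \<Phi>: "\<Phi> \<in> N \<rightarrow>\<^sub>M mat_lebesgue k p"
    and \<Phi>T: "\<And>y. y \<in> carrier_mat n p \<Longrightarrow> \<Phi> (T y) = Mn y"
  shows "is_the_bayes_estimator M N (\<lambda>\<omega>. T (Y \<omega>)) (mat_lebesgue k p)
    (\<lambda>\<omega>. quadratic_loss W (Sig \<omega>) (Par \<omega>)) \<Phi>"
proof -
  let ?Ln = "mat_lebesgue n p" and ?Lk = "mat_lebesgue k p" and ?Lp = "mat_lebesgue p p"
  let ?MY = "\<lambda>\<omega>. Mn (Y \<omega>)"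
  have Wc: "W \<in> carrier_mat k k"
    unfolding W using R by (auto intro!: mult_carrier_mat[of _ k k])
  have YT: "(\<lambda>\<omega>. T (Y \<omega>)) \<in> M \<rightarrow>\<^sub>M N" by (rule measurable_compose[OF Y T])
  have MY: "?MY \<in> M \<rightarrow>\<^sub>M ?Lk" by (rule measurable_compose[OF Y Mn])
  have \<Phi>Y: "\<Phi> (T (Y \<omega>)) = Mn (Y \<omega>)" if "\<omega> \<in> space M" for \<omega>
    using \<Phi>T measurable_mat_lebesgueD(1)[OF Y that] by simp
  have loss_meas: "(\<lambda>\<omega>. ennreal (trace_form (Sig \<omega>) W (a \<omega> - b \<omega>))) \<in> borel_measurable M"
    if "a \<in> M \<rightarrow>\<^sub>M ?Lk" "b \<in> M \<rightarrow>\<^sub>M ?Lk" for a b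
    using that by (intro measurable_compose[OF _ measurable_ennreal]
        mat_meas_trace_form[OF Sig Wc] mat_meas_diff)
  define q where "q = (\<lambda>\<Phi>' \<omega>. ennreal (trace_form (Sig \<omega>) W (Mn (Y \<omega>) - \<Phi>' (T (Y \<omega>)))))"
  have q_meas: "q \<Phi>' \<in> borel_measurable M" if "\<Phi>' \<in> N \<rightarrow>\<^sub>M ?Lk" for \<Phi>'
    unfolding q_def by (intro loss_meas MY measurable_compose[OF YT that])
  have decomp: "(\<integral>\<^sup>+\<omega>. ennreal (trace_form (Sig \<omega>) W (Par \<omega> - \<Phi>' (T (Y \<omega>)))) * indicator A (T (Y \<omega>)) \<partial>M)
      = (\<integral>\<^sup>+\<omega>. (ennreal (trace_form (Sig \<omega>) W (Par \<omega> - \<Phi> (T (Y \<omega>)))) + q \<Phi>' \<omega>) * indicator A (T (Y \<omega>)) \<partial>M)"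
    if \<Phi>': "\<Phi>' \<in> N \<rightarrow>\<^sub>M ?Lk" and A: "A \<in> sets N" for \<Phi>' A
  proof -
    let ?F = "\<lambda>\<omega>. \<Phi>' (T (Y \<omega>))" and ?I = "\<lambda>\<omega>. indicator A (T (Y \<omega>)) :: ennreal"
    let ?r = "\<lambda>\<omega>. 2 \<cdot>\<^sub>m Mn (Y \<omega>) + (-1) \<cdot>\<^sub>m Par \<omega>"
    let ?a = "\<lambda>\<omega>. trace_form (Sig \<omega>) W (Par \<omega> - ?F \<omega>)"
    let ?b = "\<lambda>\<omega>. trace_form (Sig \<omega>) W (?r \<omega> - ?F \<omega>)"
    let ?c = "\<lambda>\<omega>. trace_form (Sig \<omega>) W (Par \<omega> - Mn (Y \<omega>))"
    let ?e = "\<lambda>\<omega>. trace_form (Sig \<omega>) W (Mn (Y \<omega>) - ?F \<omega>)"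
    have F: "?F \<in> M \<rightarrow>\<^sub>M ?Lk" by (rule measurable_compose[OF YT \<Phi>'])
    have I: "?I \<in> borel_measurable M"
      by (rule measurable_compose[OF YT borel_measurable_indicator[OF A]])
    have r: "?r \<in> M \<rightarrow>\<^sub>M ?Lk"
    proof (rule measurable_cong[THEN iffD1, rotated])
      show "(\<lambda>\<omega>. 2 \<cdot>\<^sub>m Mn (Y \<omega>) - Par \<omega>) \<in> M \<rightarrow>\<^sub>M ?Lk"
        by (intro mat_meas_diff mat_meas_smult MY Par) simp
      fix \<omega> assume \<omega>: "\<omega> \<in> space M"
      show "2 \<cdot>\<^sub>m Mn (Y \<omega>) - Par \<omega> = ?r \<omega>"
        using measurable_mat_lebesgueD(1)[OF MY \<omega>] measurable_mat_lebesgueD(1)[OF Par \<omega>]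
        by (intro eq_matI) auto
    qed
    \<comment> \<open>The loss restricted to {T in A}, as a function of observation, parameter and
      covariance. The estimate and the indicator depend on the observation alone, so reflecting the
      parameter leaves them unchanged.\<close>
    define h where "h = (\<lambda>z. ennreal (trace_form (snd (snd z)) W (fst (snd z) - \<Phi>' (T (fst z))))
      * (indicator A (T (fst z)) :: ennreal))"
    have "h \<in> borel_measurable (?Ln \<Otimes>\<^sub>M (?Lk \<Otimes>\<^sub>M ?Lp))"
      unfolding h_def
    proof (rule borel_measurable_times_ennreal)
      have T1: "(\<lambda>z. T (fst z)) \<in> ?Ln \<Otimes>\<^sub>M (?Lk \<Otimes>\<^sub>M ?Lp) \<rightarrow>\<^sub>M N"
        by (rule measurable_compose[OF measurable_fst T])
      show "(\<lambda>z. indicator A (T (fst z)) :: ennreal) \<in> borel_measurable (?Ln \<Otimes>\<^sub>M (?Lk \<Otimes>\<^sub>M ?Lp))"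
        by (rule measurable_compose[OF T1 borel_measurable_indicator[OF A]])
      show "(\<lambda>z. ennreal (trace_form (snd (snd z)) W (fst (snd z) - \<Phi>' (T (fst z)))))
          \<in> borel_measurable (?Ln \<Otimes>\<^sub>M (?Lk \<Otimes>\<^sub>M ?Lp))"
        by (intro measurable_compose[OF _ measurable_ennreal] mat_meas_trace_form[OF _ Wc, of _ _ p]
            mat_meas_diff measurable_compose[OF T1 \<Phi>']) auto
    qed
    from refl[OF this]
    have "(\<integral>\<^sup>+\<omega>. ennreal (?a \<omega>) * ?I \<omega> \<partial>M) = (\<integral>\<^sup>+\<omega>. ennreal (?b \<omega>) * ?I \<omega> \<partial>M)"
      by (simp add: h_def)
    then have "2 * (\<integral>\<^sup>+\<omega>. ennreal (?a \<omega>) * ?I \<omega> \<partial>M)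
        = (\<integral>\<^sup>+\<omega>. ennreal (?a \<omega>) * ?I \<omega> \<partial>M) + (\<integral>\<^sup>+\<omega>. ennreal (?b \<omega>) * ?I \<omega> \<partial>M)"
      by (simp add: mult_2)
    also have "\<dots> = (\<integral>\<^sup>+\<omega>. ennreal (?a \<omega>) * ?I \<omega> + ennreal (?b \<omega>) * ?I \<omega> \<partial>M)"
      by (intro nn_integral_add[symmetric] borel_measurable_times_ennreal loss_meas Par F r I)
    also have "\<dots> = (\<integral>\<^sup>+\<omega>. 2 * ((ennreal (?c \<omega>) + ennreal (?e \<omega>)) * ?I \<omega>) \<partial>M)"
    proof (rule nn_integral_cong_AE)
      show "AE \<omega> in M. ennreal (?a \<omega>) * ?I \<omega> + ennreal (?b \<omega>) * ?I \<omega>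
          = 2 * ((ennreal (?c \<omega>) + ennreal (?e \<omega>)) * ?I \<omega>)"
        using pos AE_space
      proof eventually_elim
        case (elim \<omega>)
        note car = measurable_mat_lebesgueD(1)[OF _ elim(2)]
        have nn: "trace_form (Sig \<omega>) W (u - v) \<ge> 0" if "u \<in> carrier_mat k p" "v \<in> carrier_mat k p" for u v
          using that by (intro trace_form_nonneg[OF elim(1) R(1) _ w W]) (auto intro: minus_carrier_mat)
        have "?a \<omega> + ?b \<omega> = 2 * ?c \<omega> + 2 * ?e \<omega>"
          using Wc car[OF Sig] car[OF Par] car[OF MY] car[OF F] by (intro trace_form_parallelogram)
        moreover have "?a \<omega> \<ge> 0" "?b \<omega> \<ge> 0" "?c \<omega> \<ge> 0" "?e \<omega> \<ge> 0"
          using car[OF Par] car[OF MY] car[OF F] car[OF r] by (auto intro: nn)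
        ultimately have "ennreal (?a \<omega>) + ennreal (?b \<omega>) = 2 * (ennreal (?c \<omega>) + ennreal (?e \<omega>))"
          by (rule ennreal_add_eq_double)
        then show ?case
          by (simp only: mult.assoc distrib_right[symmetric])
      qed
    qed
    also have "\<dots> = 2 * (\<integral>\<^sup>+\<omega>. (ennreal (?c \<omega>) + ennreal (?e \<omega>)) * ?I \<omega> \<partial>M)"
      by (intro nn_integral_cmult borel_measurable_times_ennreal borel_measurable_add loss_meas Par F MY I)
    \<comment> \<open>Cancelling the factor 2 is legitimate even where the integrals are infinite,
      because 2 is neither zero nor infinite.\<close>
    finally have "(\<integral>\<^sup>+\<omega>. ennreal (?a \<omega>) * ?I \<omega> \<partial>M)
        = (\<integral>\<^sup>+\<omega>. (ennreal (?c \<omega>) + ennreal (?e \<omega>)) * ?I \<omega> \<partial>M)"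
      by (simp add: ennreal_mult_cancel_left)
    also have "\<dots> = (\<integral>\<^sup>+\<omega>. (ennreal (trace_form (Sig \<omega>) W (Par \<omega> - \<Phi> (T (Y \<omega>)))) + q \<Phi>' \<omega>) * ?I \<omega> \<partial>M)"
      by (intro nn_integral_cong) (simp add: \<Phi>Y q_def)
    finally show ?thesis .
  qed
  show ?thesis
  proof (rule is_the_bayes_estimatorI[OF M YT \<Phi>, where q = q])
    fix \<Phi>' assume \<Phi>': "\<Phi>' \<in> N \<rightarrow>\<^sub>M ?Lk"
    show "(\<lambda>\<omega>. ennreal (quadratic_loss W (Sig \<omega>) (Par \<omega>) (\<Phi>' (T (Y \<omega>))))) \<in> borel_measurable M"
      unfolding quadratic_loss_eq by (intro loss_meas Par measurable_compose[OF YT \<Phi>'])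
    show "q \<Phi>' \<in> borel_measurable M" by (rule q_meas[OF \<Phi>'])
    show "(\<integral>\<^sup>+\<omega>. ennreal (quadratic_loss W (Sig \<omega>) (Par \<omega>) (\<Phi>' (T (Y \<omega>)))) * indicator A (T (Y \<omega>)) \<partial>M)
        = (\<integral>\<^sup>+\<omega>. (ennreal (quadratic_loss W (Sig \<omega>) (Par \<omega>) (\<Phi> (T (Y \<omega>)))) + q \<Phi>' \<omega>)
            * indicator A (T (Y \<omega>)) \<partial>M)" if "A \<in> sets N" for A
      unfolding quadratic_loss_eq by (rule decomp[OF \<Phi>' that])
    show "AE \<omega> in M. q \<Phi>' \<omega> = 0 \<longrightarrow> \<Phi>' (T (Y \<omega>)) = \<Phi> (T (Y \<omega>))"
      using pos AE_space
    proof eventually_elim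
      case (elim \<omega>)
      have My: "Mn (Y \<omega>) \<in> carrier_mat k p" and F: "\<Phi>' (T (Y \<omega>)) \<in> carrier_mat k p"
        using measurable_mat_lebesgueD(1)[OF MY elim(2)]
          measurable_mat_lebesgueD(1)[OF measurable_compose[OF YT \<Phi>'] elim(2)] by auto
      have D: "Mn (Y \<omega>) - \<Phi>' (T (Y \<omega>)) \<in> carrier_mat k p"
        using F by (rule minus_carrier_mat)
      show ?case
      proof
        assume "q \<Phi>' \<omega> = 0"
        \<comment> \<open>A vanishing \<open>ennreal\<close> value only says that the form is at
          most zero; nonnegativity makes it equal to zero.\<close>
        then have "trace_form (Sig \<omega>) W (Mn (Y \<omega>) - \<Phi>' (T (Y \<omega>))) = 0"
          using trace_form_nonneg[OF elim(1) R(1) D w W] by (simp add: q_def ennreal_eq_0_iff)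
        then have 0: "Mn (Y \<omega>) - \<Phi>' (T (Y \<omega>)) = 0\<^sub>m k p"
          by (intro trace_form_eq_0[OF elim(1) R(1) D w W R(2,3)])
        have "\<Phi>' (T (Y \<omega>)) = Mn (Y \<omega>)"
        proof (rule eq_matI)
          fix i j assume "i < dim_row (Mn (Y \<omega>))" "j < dim_col (Mn (Y \<omega>))"
          then show "\<Phi>' (T (Y \<omega>)) $$ (i, j) = Mn (Y \<omega>) $$ (i, j)"
            using arg_cong[OF 0, of "\<lambda>X. X $$ (i, j)"] My F by auto
        qed (use My F in auto)
        then show "\<Phi>' (T (Y \<omega>)) = \<Phi> (T (Y \<omega>))"
          using \<Phi>Y[OF elim(2)] by simp
      qed
    qed
  next
    \<comment> \<open>The decomposition is applied to the constant estimator zero: its loss is the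
      plain second moment of the parameter, and dropping the nonnegative excess leaves the risk of
      the centre.\<close>
    have zero: "(\<lambda>_. 0\<^sub>m k p) \<in> N \<rightarrow>\<^sub>M ?Lk" by (rule mat_meas_const) simp
    have ind: "indicator (space N) (T (Y \<omega>)) = (1 :: ennreal)" if "\<omega> \<in> space M" for \<omega>
      using measurable_space[OF YT that] by simp
    have "(\<integral>\<^sup>+\<omega>. ennreal (trace_form (Sig \<omega>) W (Par \<omega> - \<Phi> (T (Y \<omega>)))) \<partial>M)
        \<le> (\<integral>\<^sup>+\<omega>. (ennreal (trace_form (Sig \<omega>) W (Par \<omega> - \<Phi> (T (Y \<omega>)))) + q (\<lambda>_. 0\<^sub>m k p) \<omega>)
            * indicator (space N) (T (Y \<omega>)) \<partial>M)"
      by (intro nn_integral_mono) (simp add: ind)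
    also have "\<dots> = (\<integral>\<^sup>+\<omega>. ennreal (trace_form (Sig \<omega>) W (Par \<omega> - 0\<^sub>m k p))
        * indicator (space N) (T (Y \<omega>)) \<partial>M)"
      by (rule decomp[OF zero, symmetric]) simp
    also have "\<dots> = (\<integral>\<^sup>+\<omega>. ennreal (trace_form (Sig \<omega>) W (Par \<omega>)) \<partial>M)"
    proof (rule nn_integral_cong)
      fix \<omega> assume \<omega>: "\<omega> \<in> space M"
      have "Par \<omega> - 0\<^sub>m k p = Par \<omega>"
        using measurable_mat_lebesgueD(1)[OF Par \<omega>] by (intro eq_matI) auto
      then show "ennreal (trace_form (Sig \<omega>) W (Par \<omega> - 0\<^sub>m k p)) * indicator (space N) (T (Y \<omega>))
          = ennreal (trace_form (Sig \<omega>) W (Par \<omega>))"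
        by (simp add: ind[OF \<omega>])
    qed
    also note fin
    finally show "(\<integral>\<^sup>+\<omega>. ennreal (quadratic_loss W (Sig \<omega>) (Par \<omega>) (\<Phi> (T (Y \<omega>)))) \<partial>M) < \<infinity>"
      by (simp add: quadratic_loss_eq)
  qed
qed

text \<open>Conditionally on Sigma the weighted second moment is at most a constant times the mass
  of the prior density. As the constant does not involve Sigma, averaging gives a finite bound
  whatever the law of Sigma is.\<close>

lemma gaussian_prior_moment_finite:
  assumes M: "prob_space M"
    and prior: "has_cond_distr M (mat_lebesgue k p) Theta (mat_lebesgue p p) Sig
        (\<lambda>S. matrix_normal k p (0\<^sub>m k p) S (mat_diag k g))"
    and pos: "AE \<omega> in M. pos_def_mat p (Sig \<omega>)"
    and g: "\<And>i. i < k \<Longrightarrow> g i > 0" and w: "\<And>i. i < k \<Longrightarrow> w i > 0"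
  shows "(\<integral>\<^sup>+\<omega>. ennreal (trace_form (Sig \<omega>) (mat_diag k w) (Theta \<omega>)) \<partial>M) < \<infinity>"
proof -
  interpret prob_space M by fact
  let ?Lk = "mat_lebesgue k p" and ?Lp = "mat_lebesgue p p"
  let ?f = "\<lambda>S x. ennreal (matrix_normal_density k p (0\<^sub>m k p) S (mat_diag k g) x)"
  \<comment> \<open>A sum of nonnegative terms dominates each of them, so \<kappa> is one constant
    with w i \<le> \<kappa> / g i for all rows; it also covers k = 0.\<close>
  define \<kappa> where "\<kappa> = (\<Sum>i<k. w i * g i)"
  have \<kappa>: "w i \<le> \<kappa> / g i" if "i < k" for i
    using member_le_sum[of i "{..<k}" "\<lambda>i. w i * g i"] g w that
    by (simp add: \<kappa>_def pos_le_divide_eq less_imp_le)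
  have \<kappa>0: "\<kappa> \<ge> 0"
    unfolding \<kappa>_def using g w by (intro sum_nonneg) (simp add: less_imp_le)
  have fm: "(\<lambda>(x, S). ?f S x) \<in> borel_measurable (?Lk \<Otimes>\<^sub>M ?Lp)"
    unfolding case_prod_beta
    by (intro measurable_compose[OF _ measurable_ennreal] mat_meas_matrix_normal_density mat_meas_const) auto
  have tm: "(\<lambda>z. ennreal (trace_form (snd z) (mat_diag k w) (fst z))) \<in> borel_measurable (?Lk \<Otimes>\<^sub>M ?Lp)"
    by (intro measurable_compose[OF _ measurable_ennreal] mat_meas_trace_form[of _ _ p]) auto
  note cond = nn_integral_has_cond_distr_density[OF finite_measure_axioms prior sigma_finite_mat_lebesgue _ fm]
  \<comment> \<open>Testing the conditional law with the constant 1 gives the average mass of the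
    density, so the Gaussian integral itself is not computed.\<close>
  have mass: "(\<integral>\<^sup>+\<omega>. (\<integral>\<^sup>+x. ?f (Sig \<omega>) x \<partial>?Lk) \<partial>M) = 1"
    using cond[of "\<lambda>_. 1"] by (simp add: matrix_normal_def emeasure_space_1)
  have "(\<integral>\<^sup>+\<omega>. ennreal (trace_form (Sig \<omega>) (mat_diag k w) (Theta \<omega>)) \<partial>M)
      = (\<integral>\<^sup>+\<omega>. (\<integral>\<^sup>+x. ?f (Sig \<omega>) x * ennreal (trace_form (Sig \<omega>) (mat_diag k w) x) \<partial>?Lk) \<partial>M)"
    using cond[OF _ tm] by (simp add: matrix_normal_def)
  also have "\<dots> \<le> (\<integral>\<^sup>+\<omega>. ennreal (4 * \<kappa> * sqrt 2 ^ (k * p)) * (\<integral>\<^sup>+x. ?f (Sig \<omega>) x \<partial>?Lk) \<partial>M)"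
  proof (rule nn_integral_mono_AE)
    show "AE \<omega> in M. (\<integral>\<^sup>+x. ?f (Sig \<omega>) x * ennreal (trace_form (Sig \<omega>) (mat_diag k w) x) \<partial>?Lk)
        \<le> ennreal (4 * \<kappa> * sqrt 2 ^ (k * p)) * (\<integral>\<^sup>+x. ?f (Sig \<omega>) x \<partial>?Lk)"
      using pos by eventually_elim
        (intro nn_integral_matrix_normal_trace_form_le g \<kappa> \<kappa>0)
  qed
  also have "\<dots> = ennreal (4 * \<kappa> * sqrt 2 ^ (k * p)) * (\<integral>\<^sup>+\<omega>. (\<integral>\<^sup>+x. ?f (Sig \<omega>) x \<partial>?Lk) \<partial>M)"
  proof (rule nn_integral_cmult)
    have "(\<lambda>(S, x). ?f S x) \<in> borel_measurable (?Lp \<Otimes>\<^sub>M ?Lk)"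
      using measurable_compose[OF measurable_pair_swap' fm] by (simp add: case_prod_beta)
    then have "(\<lambda>S. \<integral>\<^sup>+x. ?f S x \<partial>?Lk) \<in> borel_measurable ?Lp"
      by (rule sigma_finite_measure.borel_measurable_nn_integral[OF sigma_finite_mat_lebesgue])
    moreover have "Sig \<in> M \<rightarrow>\<^sub>M ?Lp"
      using prior unfolding has_cond_distr_def by blast
    ultimately show "(\<lambda>\<omega>. \<integral>\<^sup>+x. ?f (Sig \<omega>) x \<partial>?Lk) \<in> borel_measurable M"
      by (rule measurable_compose[rotated])
  qed
  also have "\<dots> < \<infinity>" by (simp add: mass)
  finally show ?thesis .
qed

section \<open>Spectral form of the regression\<close>

lemma mat_diag_cong: "(\<And>i. i < k \<Longrightarrow> f i = g i) \<Longrightarrow> mat_diag k f = mat_diag k g"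
  by (intro eq_matI) (auto simp: mat_diag_def)

lemma mat_diag_eq_one: "(\<And>i. i < k \<Longrightarrow> f i = 1) \<Longrightarrow> mat_diag k f = 1\<^sub>m k"
  by (intro eq_matI) (auto simp: mat_diag_def)

lemma mat_diag_index: "i < k \<Longrightarrow> mat_diag k f $$ (i, i) = f i"
  by (simp add: mat_diag_def)

lemma mat_diag_add: "mat_diag k f + mat_diag k g = mat_diag k (\<lambda>i. f i + g i :: real)"
  by (intro eq_matI) (auto simp: mat_diag_def)

lemma one_minus_mat_diag: "1\<^sub>m k - mat_diag k g = mat_diag k (\<lambda>i. 1 - g i :: real)"
  by (intro eq_matI) (auto simp: mat_diag_def)

lemma mat_diag_minus_one: "mat_diag k g - 1\<^sub>m k = mat_diag k (\<lambda>i. g i - 1 :: real)"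
  by (intro eq_matI) (auto simp: mat_diag_def)

lemma transpose_mat_diag[simp]: "transpose_mat (mat_diag k f) = mat_diag k f"
  by (intro eq_matI) (auto simp: mat_diag_def)

lemma pos_def_mat_diag_pos:
  assumes "pos_def_mat k (mat_diag k g)" "i < k"
  shows "g i > 0"
proof -
  have "scalar_prod (unit_vec k i) (mat_diag k g *\<^sub>v unit_vec k i) = g i"
  proof -
    have "mat_diag k g *\<^sub>v unit_vec k i \<in> carrier_vec k"
      by (rule mult_mat_vec_carrier[OF mat_diag_dim]) simp
    then have "scalar_prod (unit_vec k i) (mat_diag k g *\<^sub>v unit_vec k i)
        = scalar_prod (row (mat_diag k g) i) (unit_vec k i)"
      using assms(2) by (simp add: scalar_prod_left_unit[of _ k] mat_diag_def)
    also have "\<dots> = g i"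
      using assms(2) by (simp add: scalar_prod_right_unit mat_diag_def)
    finally show ?thesis .
  qed
  moreover have "unit_vec k i \<noteq> (0\<^sub>v k :: real vec)"
    using assms(2) by (metis index_unit_vec(2) index_zero_vec(1) zero_neq_one)
  ultimately show ?thesis
    using assms unfolding pos_def_mat_def by (metis unit_vec_carrier)
qed

text \<open>The orthogonal matrix that diagonalises the inverse of the Gram matrix also diagonalises
  the Gram matrix, with reciprocal entries. Thus A P has orthogonal columns of squared norm 1 / d i,
  which settles the sign of d i.\<close>

lemma gram_spectral:
  assumes A: "A \<in> carrier_mat n k" and P: "P \<in> carrier_mat k k" "transpose_mat P * P = 1\<^sub>m k"
    and D: "transpose_mat P * mat_inv (transpose_mat A * A) * P = mat_diag k d"
    and nz: "\<forall>i<k. d i \<noteq> 0"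
  shows "P * transpose_mat P = 1\<^sub>m k"
    and "\<And>i. i < k \<Longrightarrow> d i > 0"
    and "transpose_mat (A * P) * (A * P) = mat_diag k (\<lambda>i. 1 / d i)"
    and "transpose_mat A * A = P * mat_diag k (\<lambda>i. 1 / d i) * transpose_mat P"
proof -
  let ?N = "transpose_mat A * A" and ?Z = "A * P"
  have d: "d i \<noteq> 0" if "i < k" for i using nz that by simp
  have Pt: "transpose_mat P \<in> carrier_mat k k" using P by simp
  show PP: "P * transpose_mat P = 1\<^sub>m k"
    by (rule mat_mult_left_right_inverse[OF Pt P])
  have N: "?N \<in> carrier_mat k k" using A by simp
  have Ni: "mat_inv ?N \<in> carrier_mat k k" using N by simp
  have Z: "?Z \<in> carrier_mat n k" using A P by simp
  have ZZ: "transpose_mat ?Z * ?Z = transpose_mat P * ?N * P"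
  proof -
    have At: "transpose_mat A \<in> carrier_mat k n" using A by simp
    have "transpose_mat ?Z * ?Z = transpose_mat P * transpose_mat A * (A * P)"
      by (simp add: transpose_mult[OF A P(1)])
    also have "\<dots> = transpose_mat P * transpose_mat A * A * P"
      by (rule assoc_mult_mat[OF mult_carrier_mat[OF Pt At] A P(1), symmetric])
    also have "transpose_mat P * transpose_mat A * A = transpose_mat P * ?N"
      by (rule assoc_mult_mat[OF Pt At A])
    finally show ?thesis .
  qed
  have ZZc: "transpose_mat ?Z * ?Z \<in> carrier_mat k k" using Z by simp
  \<comment> \<open>\<open>mat_inv\<close> of a singular matrix is zero, which would make all \<open>d i\<close> vanish.\<close>
  have "Determinant.det ?N \<noteq> 0"
  proof
    assume det: "Determinant.det ?N = 0"
    then have "mat_inv ?N = 0\<^sub>m k k"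
      using mat_inv_eq_adj[OF N] by simp
    then have "mat_diag k d = 0\<^sub>m k k"
      using D P Pt by simp
    then have "d i = 0" if "i < k" for i
      using mat_diag_index[OF that, of d] that by simp
    with d have "k = 0" by (metis gr0I)
    with det N show False by (simp add: det_dim_zero)
  qed
  then have NiN: "mat_inv ?N * ?N = 1\<^sub>m k"
    by (rule mat_inv_mult(2)[OF N])
  \<comment> \<open>Between the inverse Gram matrix and the Gram matrix stands P times its
    transpose, which is the identity; the product then collapses to the transpose of P times
    P.\<close>
  have DZ: "mat_diag k d * (transpose_mat ?Z * ?Z) = 1\<^sub>m k"
  proof -
    have L: "transpose_mat P * mat_inv ?N \<in> carrier_mat k k"
      by (rule mult_carrier_mat[OF Pt Ni])
    have "mat_diag k d * (transpose_mat ?Z * ?Z)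
        = transpose_mat P * mat_inv ?N * P * (transpose_mat P * (?N * P))"
      unfolding ZZ D[symmetric] assoc_mult_mat[OF Pt N P(1)] ..
    also have "\<dots> = transpose_mat P * mat_inv ?N * (P * (transpose_mat P * (?N * P)))"
      by (rule assoc_mult_mat[OF L P(1) mult_carrier_mat[OF Pt mult_carrier_mat[OF N P(1)]]])
    also have "P * (transpose_mat P * (?N * P)) = P * transpose_mat P * (?N * P)"
      by (rule assoc_mult_mat[OF P(1) Pt mult_carrier_mat[OF N P(1)], symmetric])
    also have "\<dots> = ?N * P"
      unfolding PP by (rule left_mult_one_mat[OF mult_carrier_mat[OF N P(1)]])
    also have "transpose_mat P * mat_inv ?N * (?N * P) = transpose_mat P * (mat_inv ?N * (?N * P))"
      by (rule assoc_mult_mat[OF Pt Ni mult_carrier_mat[OF N P(1)]])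
    also have "mat_inv ?N * (?N * P) = mat_inv ?N * ?N * P"
      by (rule assoc_mult_mat[OF Ni N P(1), symmetric])
    also have "\<dots> = P"
      unfolding NiN by (rule left_mult_one_mat[OF P(1)])
    finally show ?thesis by (simp add: P(2))
  qed
  show ZZd: "transpose_mat ?Z * ?Z = mat_diag k (\<lambda>i. 1 / d i)"
    using mat_inv_eqI[OF mat_diag_dim ZZc DZ] mat_inv_mat_diag[of k d] d by simp
  show "d i > 0" if i: "i < k" for i
  proof -
    \<comment> \<open>The diagonal entry at i is the squared norm of column i of A P.\<close>
    have "1 / d i = (\<Sum>l<n. ?Z $$ (l, i) * ?Z $$ (l, i))"
      using arg_cong[OF ZZd, of "\<lambda>X. X $$ (i, i)"] i Z
        mat_mult_entry[of "transpose_mat ?Z" k n ?Z k i i]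
      by (simp add: mat_diag_index del: index_mult_mat)
    also have "\<dots> \<ge> 0" by (intro sum_nonneg) simp
    finally show ?thesis using d[OF i] by simp
  qed
  have "P * mat_diag k (\<lambda>i. 1 / d i) * transpose_mat P = P * (transpose_mat P * ?N * P) * transpose_mat P"
    using ZZd ZZ by simp
  also have "P * (transpose_mat P * ?N * P) = P * (transpose_mat P * ?N) * P"
    by (rule assoc_mult_mat[OF P(1) mult_carrier_mat[OF Pt N] P(1), symmetric])
  also have "P * (transpose_mat P * ?N) = P * transpose_mat P * ?N"
    by (rule assoc_mult_mat[OF P(1) Pt N, symmetric])
  also have "\<dots> = ?N"
    unfolding PP by (rule left_mult_one_mat[OF N])
  also have "?N * P * transpose_mat P = ?N * (P * transpose_mat P)"
    by (rule assoc_mult_mat[OF N P(1) Pt])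
  also have "\<dots> = ?N"
    unfolding PP by (rule right_mult_one_mat[OF N])
  finally show "transpose_mat A * A = P * mat_diag k (\<lambda>i. 1 / d i) * transpose_mat P" ..
qed

text \<open>Conjugation by an orthogonal matrix is multiplicative, so inverting such a product
  amounts to inverting the diagonal entries.\<close>

lemma orthogonal_diag_mult:
  assumes P: "P \<in> carrier_mat k k" "transpose_mat P * P = 1\<^sub>m k"
  shows "(P * mat_diag k a * transpose_mat P) * (P * mat_diag k b * transpose_mat P)
    = P * mat_diag k (\<lambda>i. a i * b i :: real) * transpose_mat P"
proof -
  let ?a = "mat_diag k a" and ?b = "mat_diag k b"
  have Pt: "transpose_mat P \<in> carrier_mat k k" using P by simp
  note a = mat_diag_dim[of k a] and b = mat_diag_dim[of k b]
  note Pa = mult_carrier_mat[OF P(1) a] and Pb = mult_carrier_mat[OF P(1) b]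
  note Pb' = mult_carrier_mat[OF Pb Pt]
  have "(P * ?a * transpose_mat P) * (P * ?b * transpose_mat P)
      = P * ?a * (transpose_mat P * (P * ?b * transpose_mat P))"
    by (rule assoc_mult_mat[OF Pa Pt Pb'])
  also have "transpose_mat P * (P * ?b * transpose_mat P) = transpose_mat P * (P * (?b * transpose_mat P))"
    by (simp only: assoc_mult_mat[OF P(1) b Pt])
  also have "\<dots> = transpose_mat P * P * (?b * transpose_mat P)"
    by (rule assoc_mult_mat[OF Pt P(1) mult_carrier_mat[OF b Pt], symmetric])
  also have "\<dots> = ?b * transpose_mat P"
    unfolding P(2) by (rule left_mult_one_mat[OF mult_carrier_mat[OF b Pt]])
  also have "P * ?a * (?b * transpose_mat P) = P * ?a * ?b * transpose_mat P"
    by (rule assoc_mult_mat[OF Pa b Pt, symmetric])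
  also have "P * ?a * ?b = P * (?a * ?b)"
    by (rule assoc_mult_mat[OF P(1) a b])
  finally show ?thesis by simp
qed

lemma is_generalized_ridge_of_shrinkage:
  assumes A: "A \<in> carrier_mat n k" and P: "P \<in> carrier_mat k k" "transpose_mat P * P = 1\<^sub>m k"
    and gram: "transpose_mat A * A = P * mat_diag k (\<lambda>i. 1 / d i) * transpose_mat P"
    and d: "\<And>i. i < k \<Longrightarrow> d i > 0" and e: "\<And>i. i < k \<Longrightarrow> e i > 0"
  shows "is_generalized_ridge n p k A P
    (\<lambda>y. P * mat_diag k e * mat_diag k d * transpose_mat P * transpose_mat A * y)"
proof -
  \<comment> \<open>The regularised Gram matrix has eigenvalues 1 / d i + K i, and its inverse must
    have eigenvalues e i * d i; this equation determines K. For e i = 1 - lam i / c i the entry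
    equals lam i / ((c i - lam i) * d i), which is the inverse of the prior row variance.\<close>
  define K where "K = mat_diag k (\<lambda>i. 1 / (e i * d i) - 1 / d i)"
  have Pt: "transpose_mat P \<in> carrier_mat k k" using P by simp
  have PP: "P * transpose_mat P = 1\<^sub>m k"
    by (rule mat_mult_left_right_inverse[OF Pt P])
  let ?D = "mat_diag k (\<lambda>i. 1 / d i)"
  let ?S = "transpose_mat A * A + P * K * transpose_mat P"
  let ?I = "P * mat_diag k (\<lambda>i. e i * d i) * transpose_mat P"
  have K: "K \<in> carrier_mat k k" by (simp add: K_def)
  note PD = mult_carrier_mat[OF P(1) mat_diag_dim[of k "\<lambda>i. 1 / d i"]] and PK = mult_carrier_mat[OF P(1) K]
  have "?S = (P * ?D + P * K) * transpose_mat P"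
    unfolding gram by (rule add_mult_distrib_mat[OF PD PK Pt, symmetric])
  also have "P * ?D + P * K = P * (?D + K)"
    by (rule mult_add_distrib_mat[OF P(1) mat_diag_dim K, symmetric])
  also have "?D + K = mat_diag k (\<lambda>i. 1 / (e i * d i))"
    unfolding K_def mat_diag_add by (intro mat_diag_cong) simp
  finally have S: "?S = P * mat_diag k (\<lambda>i. 1 / (e i * d i)) * transpose_mat P" .
  have one: "mat_diag k (\<lambda>i. 1 / (e i * d i) * (e i * d i)) = 1\<^sub>m k"
      "mat_diag k (\<lambda>i. e i * d i * (1 / (e i * d i))) = 1\<^sub>m k"
    using d e by (auto intro!: mat_diag_eq_one simp: less_imp_neq[symmetric])
  have Sc: "?S \<in> carrier_mat k k" and Ic: "?I \<in> carrier_mat k k"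
    unfolding S using P Pt by (auto intro!: mult_carrier_mat[of _ k k])
  have SI: "?S * ?I = 1\<^sub>m k" and IS: "?I * ?S = 1\<^sub>m k"
    unfolding S orthogonal_diag_mult[OF P] one using P PP by auto
  have "invertible_mat ?S"
    unfolding invertible_mat_def inverts_mat_def square_mat.simps
  proof (intro conjI exI[of _ ?I])
    show "dim_col ?S = dim_row ?S" using carrier_matD[OF Sc] by simp
    show "?S * ?I = 1\<^sub>m (dim_row ?S)" unfolding carrier_matD(1)[OF Sc] by (rule SI)
    show "?I * ?S = 1\<^sub>m (dim_row ?I)" unfolding carrier_matD(1)[OF Ic] by (rule IS)
  qed
  moreover have inv: "mat_inv ?S = ?I"
    by (rule mat_inv_eqI[OF Sc Ic SI])
  moreover have "?I = P * mat_diag k e * mat_diag k d * transpose_mat P"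
    using P by (simp flip: mat_diag_diag add: assoc_mult_mat[of _ k k _ k _ k])
  moreover have "diagonal_mat K"
    by (auto simp: K_def diagonal_mat_def mat_diag_def)
  ultimately show ?thesis
    unfolding is_generalized_ridge_def using K by (intro bexI[of _ K]) auto
qed

text \<open>Observing (X_J, S_J) or the whole of Y leads to the same estimator because the posterior
  centre is a function of X_J. The two losses correspond to each other under B = P Theta, so the
  centre for B is P times the centre for Theta.\<close>

theorem theorem1:
  fixes n p k kJ :: nat and J :: "nat set"
    and A AJ P D Lam C G :: "real mat"
    and d lam c :: "nat \<Rightarrow> real"
    and M :: "'w measure" and prior :: "real mat measure"
    and Sig B Theta Y :: "'w \<Rightarrow> real mat"
    and XJ SJ ThetaHat BHat :: "real mat \<Rightarrow> real mat"
  assumes A: "A \<in> carrier_mat n k" "vec_space.rank n A = k"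
    and dims: "int n - int p - int k - 1 > 0"
    and J: "J \<subseteq> {0..<k}" "kJ = card J" "AJ = submatrix A UNIV J"
    and P: "P \<in> carrier_mat kJ kJ" "transpose_mat P * P = 1\<^sub>m kJ"
    and D: "D = mat_diag kJ d" "transpose_mat P * mat_inv (transpose_mat AJ * AJ) * P = D"
      "\<forall>i j. i \<le> j \<and> j < kJ \<longrightarrow> d j \<le> d i"
    and Lam: "Lam = mat_diag kJ lam" "\<forall>i<kJ. lam i > 0"
    and C: "C = mat_diag kJ c" "\<forall>i<kJ. c i > 0"
    and G: "G = D * (mat_inv Lam * C - 1\<^sub>m kJ)" "pos_def_mat kJ G"
    and XJ: "XJ = (\<lambda>y. D * transpose_mat P * transpose_mat AJ * y)"
    and SJ: "SJ = (\<lambda>y. transpose_mat y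
                 * (1\<^sub>m n - AJ * mat_inv (transpose_mat AJ * AJ) * transpose_mat AJ) * y)"
    and M: "prob_space M"
    and B: "B \<in> M \<rightarrow>\<^sub>M mat_lebesgue kJ p"
    and Theta: "Theta = (\<lambda>\<omega>. transpose_mat P * B \<omega>)"
    and prior_Sig: "Sig \<in> M \<rightarrow>\<^sub>M mat_lebesgue p p" "distr M (mat_lebesgue p p) Sig = prior"
      "AE S in prior. pos_def_mat p S"
    and prior_Theta: "has_cond_distr M (mat_lebesgue kJ p) Theta (mat_lebesgue p p) Sig
        (\<lambda>S. matrix_normal kJ p (0\<^sub>m kJ p) S G)"
    and model: "has_cond_distr M (mat_lebesgue n p) Y
        (mat_lebesgue kJ p \<Otimes>\<^sub>M mat_lebesgue p p) (\<lambda>\<omega>. (B \<omega>, Sig \<omega>))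
        (\<lambda>(b, S). matrix_normal n p (AJ * b) S (1\<^sub>m n))"
    and cond_exp_Sig_inv:
      "cond_exp_mat_exists M
        (generated_algebra M (mat_lebesgue kJ p \<Otimes>\<^sub>M mat_lebesgue p p) (\<lambda>\<omega>. (XJ (Y \<omega>), SJ (Y \<omega>))))
        p p (\<lambda>\<omega>. mat_inv (Sig \<omega>))"
      "AE \<omega> in M. invertible_mat (cond_exp_mat M
        (generated_algebra M (mat_lebesgue kJ p \<Otimes>\<^sub>M mat_lebesgue p p) (\<lambda>\<omega>. (XJ (Y \<omega>), SJ (Y \<omega>))))
        p p (\<lambda>\<omega>. mat_inv (Sig \<omega>)) \<omega>)"
    and ThetaHat: "ThetaHat = (\<lambda>x. (1\<^sub>m kJ - Lam * mat_inv C) * x)"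
    and BHat: "BHat = (\<lambda>y. P * (1\<^sub>m kJ - Lam * mat_inv C) * D * transpose_mat P
                 * transpose_mat AJ * y)"
  shows
    \<comment> \<open>Bayes estimation from \<open>(XJ, SJ)\<close>\<close>
    "is_the_bayes_estimator M
       (mat_lebesgue kJ p \<Otimes>\<^sub>M mat_lebesgue p p) (\<lambda>\<omega>. (XJ (Y \<omega>), SJ (Y \<omega>))) (mat_lebesgue kJ p)
       (\<lambda>\<omega>. quadratic_loss (mat_inv D) (Sig \<omega>) (Theta \<omega>)) (\<lambda>(x, s). ThetaHat x)
     \<and> is_the_bayes_estimator M
       (mat_lebesgue kJ p \<Otimes>\<^sub>M mat_lebesgue p p) (\<lambda>\<omega>. (XJ (Y \<omega>), SJ (Y \<omega>))) (mat_lebesgue kJ p)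
       (\<lambda>\<omega>. quadratic_loss (transpose_mat AJ * AJ) (Sig \<omega>) (B \<omega>)) (\<lambda>(x, s). P * ThetaHat x)
     \<comment> \<open>Bayes estimation from the full observation \<open>Y\<close>\<close>
     \<and> is_the_bayes_estimator M
       (mat_lebesgue n p) Y (mat_lebesgue kJ p)
       (\<lambda>\<omega>. quadratic_loss (mat_inv D) (Sig \<omega>) (Theta \<omega>)) (\<lambda>y. ThetaHat (XJ y))
     \<and> is_the_bayes_estimator M
       (mat_lebesgue n p) Y (mat_lebesgue kJ p)
       (\<lambda>\<omega>. quadratic_loss (transpose_mat AJ * AJ) (Sig \<omega>) (B \<omega>)) BHat
     \<and> (\<forall>y \<in> carrier_mat n p. BHat y = P * ThetaHat (XJ y))
     \<and> is_generalized_ridge n p kJ AJ P BHat"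
proof -
  let ?Ln = "mat_lebesgue n p" and ?Lk = "mat_lebesgue kJ p" and ?Lp = "mat_lebesgue p p"
  interpret prob_space M by (rule M)
  have AJ: "AJ \<in> carrier_mat n kJ"
  proof -
    have "{j. j < k \<and> j \<in> J} = J" using J(1) by auto
    then show ?thesis using A J by (auto simp: dim_submatrix)
  qed
  have Pt: "transpose_mat P \<in> carrier_mat kJ kJ" using P by simp
  \<comment> \<open>The diagonals of \<open>G\<close> and of the shrinkage matrix, written in the
    form that multiplying and inverting the given diagonal matrices produces.\<close>
  define g where "g = (\<lambda>i. d i * (1 / lam i * c i - 1))"
  define e where "e = (\<lambda>i. 1 - lam i * (1 / c i))"
  have lam_c: "lam i > 0" "c i > 0" if "i < kJ" for i
    using that Lam C by auto
  have Gd: "G = mat_diag kJ g"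
    unfolding G(1) Lam(1) C(1) D(1) using lam_c
    by (subst mat_inv_mat_diag) (auto simp: mat_diag_minus_one g_def less_imp_neq[symmetric])
  have Ed: "1\<^sub>m kJ - Lam * mat_inv C = mat_diag kJ e"
    unfolding Lam(1) C(1) using lam_c
    by (subst mat_inv_mat_diag) (auto simp: one_minus_mat_diag e_def less_imp_neq[symmetric])
  have g: "g i > 0" if "i < kJ" for i
    using G(2) that unfolding Gd by (rule pos_def_mat_diag_pos)
  \<comment> \<open>Each prior variance g i carries the factor d i, so its positivity excludes d i =
    0. Only the nonvanishing is used at this point; the sign follows from the spectral
    lemma.\<close>
  have d0: "d i \<noteq> 0" if "i < kJ" for i
    using g[OF that] by (auto simp: g_def)
  then have "\<forall>i<kJ. d i \<noteq> 0" by simp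
  note spec = gram_spectral[OF AJ P D(2)[unfolded D(1)] this]
  \<comment> \<open>Since d i and g i are positive, c i exceeds lam i. The shrinkage factors are
    therefore positive, as the ridge representation requires for invertibility.\<close>
  have e: "e i > 0" if "i < kJ" for i
    using g[OF that] spec(2)[OF that] lam_c[OF that]
    by (simp add: g_def e_def zero_less_mult_iff field_simps)
  have Di: "mat_inv D = mat_diag kJ (\<lambda>i. 1 / d i)"
    unfolding D(1) using d0 by (rule mat_inv_mat_diag)
  have Gi: "mat_inv G = mat_diag kJ (\<lambda>i. 1 / g i)"
    unfolding Gd using g by (intro mat_inv_mat_diag) force
  define Mn where "Mn = (\<lambda>y. ThetaHat (XJ y))"
  have Dc: "D \<in> carrier_mat kJ kJ" by (simp add: D(1))
  have Pc: "P \<in> carrier_mat kJ kJ" by (rule P(1))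
  have AJt: "transpose_mat AJ \<in> carrier_mat kJ n" using AJ by simp
  note DPt = mult_carrier_mat[OF Dc Pt]
  note DPtA = mult_carrier_mat[OF DPt AJt]
  have XJ_meas: "XJ \<in> ?Ln \<rightarrow>\<^sub>M ?Lk"
    unfolding XJ by (intro mat_meas_mult[of _ _ kJ n] mat_meas_const[OF DPtA] measurable_ident_sets) simp
  have ThetaHat_meas: "ThetaHat \<in> ?Lk \<rightarrow>\<^sub>M ?Lk"
    unfolding ThetaHat Ed by (intro mat_meas_mult[of _ _ kJ kJ] mat_meas_const mat_diag_dim measurable_ident_sets) simp
  have Mn_meas: "Mn \<in> ?Ln \<rightarrow>\<^sub>M ?Lk"
    unfolding Mn_def by (rule measurable_compose[OF XJ_meas ThetaHat_meas])
  have PMn_meas: "(\<lambda>y. P * Mn y) \<in> ?Ln \<rightarrow>\<^sub>M ?Lk"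
    by (intro mat_meas_mult[of _ _ kJ kJ] mat_meas_const Pc Mn_meas)
  have SJ_meas: "SJ \<in> ?Ln \<rightarrow>\<^sub>M ?Lp"
  proof -
    have "AJ * mat_inv (transpose_mat AJ * AJ) * transpose_mat AJ \<in> carrier_mat n n"
      using AJ AJt by (intro mult_carrier_mat[of _ n kJ] mat_inv_carrier) auto
    then have "1\<^sub>m n - AJ * mat_inv (transpose_mat AJ * AJ) * transpose_mat AJ \<in> carrier_mat n n"
      by (rule minus_carrier_mat)
    then show ?thesis
      unfolding SJ by (intro mat_meas_mult[of _ _ p n] mat_meas_const mat_meas_transpose measurable_ident_sets) auto
  qed
  have XS_meas: "(\<lambda>y. (XJ y, SJ y)) \<in> ?Ln \<rightarrow>\<^sub>M ?Lk \<Otimes>\<^sub>M ?Lp"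
    by (intro measurable_Pair XJ_meas SJ_meas)
  \<comment> \<open>Brings the centre into the form diagonal matrix times Z^T y with Z = AJ P, where
    the posterior precision is diagonal as well.\<close>
  have Mn_eq: "Mn y = mat_diag kJ (\<lambda>i. e i * d i) * (transpose_mat (AJ * P) * y)"
    if y: "y \<in> carrier_mat n p" for y
  proof -
    have V: "transpose_mat P * transpose_mat AJ \<in> carrier_mat kJ n"
      by (rule mult_carrier_mat[OF Pt AJt])
    have "XJ y = D * (transpose_mat P * transpose_mat AJ) * y"
      unfolding XJ by (simp only: assoc_mult_mat[OF Dc Pt AJt])
    also have "\<dots> = D * (transpose_mat P * transpose_mat AJ * y)"
      by (rule assoc_mult_mat[OF Dc V y])
    finally have "Mn y = mat_diag kJ e * (D * (transpose_mat P * transpose_mat AJ * y))"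
      by (simp add: Mn_def ThetaHat Ed)
    also have "\<dots> = mat_diag kJ e * D * (transpose_mat P * transpose_mat AJ * y)"
      by (rule assoc_mult_mat[OF mat_diag_dim Dc mult_carrier_mat[OF V y], symmetric])
    finally show ?thesis
      unfolding D(1) by (simp add: transpose_mult[OF AJ P(1)])
  qed
  have normal: "\<forall>y\<in>carrier_mat n p.
    (mat_inv G + transpose_mat (AJ * P) * (AJ * P)) * Mn y = transpose_mat (AJ * P) * y"
  proof
    fix y :: "real mat" assume y: "y \<in> carrier_mat n p"
    have V: "transpose_mat (AJ * P) * y \<in> carrier_mat kJ p"
      using AJ P y by (intro mult_carrier_mat[of _ kJ n]) auto
    \<comment> \<open>Row i of the normal equations: prior precision plus data precision is the
      reciprocal of the factor e i * d i in the centre.\<close>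
    have "(1 / g i + 1 / d i) * (e i * d i) = 1" if i: "i < kJ" for i
    proof -
      \<comment> \<open>The gap between c i and lam i: in terms of it g i = d i * x / lam i and e i
        = x / (lam i + x), so every denominator is visibly nonzero.\<close>
      define x where "x = c i - lam i"
      have ci: "c i = lam i + x" by (simp add: x_def)
      have gi: "g i = d i * x / lam i" and ei: "e i = x / (lam i + x)"
        using lam_c[OF i] unfolding g_def e_def ci by (simp_all add: field_simps)
      have nz: "x \<noteq> 0" "lam i + x \<noteq> 0" "lam i \<noteq> 0"
        using g[OF i] lam_c[OF i] unfolding gi ci by auto
      have "1 / g i + 1 / d i = (lam i + x) / (d i * x)"
        using nz d0[OF i] by (simp add: gi field_simps)
      then show ?thesis
        using nz d0[OF i] by (simp add: ei)
    qed
    then have one: "mat_diag kJ (\<lambda>i. (1 / g i + 1 / d i) * (e i * d i)) = 1\<^sub>m kJ"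
      by (rule mat_diag_eq_one)
    have "(mat_inv G + transpose_mat (AJ * P) * (AJ * P)) * Mn y
        = mat_diag kJ (\<lambda>i. 1 / g i + 1 / d i) * (mat_diag kJ (\<lambda>i. e i * d i) * (transpose_mat (AJ * P) * y))"
      unfolding Mn_eq[OF y] Gi spec(3) mat_diag_add ..
    also have "\<dots> = mat_diag kJ (\<lambda>i. 1 / g i + 1 / d i) * mat_diag kJ (\<lambda>i. e i * d i) * (transpose_mat (AJ * P) * y)"
      by (rule assoc_mult_mat[OF mat_diag_dim mat_diag_dim V, symmetric])
    finally show "(mat_inv G + transpose_mat (AJ * P) * (AJ * P)) * Mn y = transpose_mat (AJ * P) * y"
      unfolding mat_diag_diag one using left_mult_one_mat[OF V] by simp
  qed
  have Gc: "G \<in> carrier_mat kJ kJ" and Git: "transpose_mat (mat_inv G) = mat_inv G"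
    unfolding Gi by (simp_all add: Gd)
  have Y: "Y \<in> M \<rightarrow>\<^sub>M ?Ln"
    using model unfolding has_cond_distr_def by blast
  have Theta_meas: "Theta \<in> M \<rightarrow>\<^sub>M ?Lk"
    using prior_Theta unfolding has_cond_distr_def by blast
  have pos: "AE \<omega> in M. pos_def_mat p (Sig \<omega>)"
    by (rule AE_distrD[OF prior_Sig(1)], unfold prior_Sig(2), rule prior_Sig(3))
  have B_car: "B \<omega> \<in> carrier_mat kJ p" if "\<omega> \<in> space M" for \<omega>
    by (rule measurable_mat_lebesgueD(1)[OF B that])
  have PTheta: "P * Theta \<omega> = B \<omega>" if "\<omega> \<in> space M" for \<omega>
    using assoc_mult_mat[OF Pc Pt B_car[OF that]] left_mult_one_mat[OF B_car[OF that]]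
    by (simp add: Theta spec(1))
  note refl_Theta = gaussian_posterior_reflection[OF finite_measure_axioms prior_Theta model AJ Gc Git
      Pc Pt spec(1) Theta Mn_meas normal]
  \<comment> \<open>P is linear, so reflecting Theta about \<open>Mn\<close> reflects B = P Theta
    about P \<open>Mn\<close>; the invariance for Theta is applied to the test function composed
    with P.\<close>
  have refl_B: "(\<integral>\<^sup>+\<omega>. h (Y \<omega>, (B \<omega>, Sig \<omega>)) \<partial>M)
      = (\<integral>\<^sup>+\<omega>. h (Y \<omega>, (2 \<cdot>\<^sub>m (P * Mn (Y \<omega>)) + (-1) \<cdot>\<^sub>m B \<omega>, Sig \<omega>)) \<partial>M)"
    if h: "h \<in> borel_measurable (?Ln \<Otimes>\<^sub>M (?Lk \<Otimes>\<^sub>M ?Lp))" for h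
  proof -
    have "(\<lambda>z. h (fst z, (P * fst (snd z), snd (snd z)))) \<in> borel_measurable (?Ln \<Otimes>\<^sub>M (?Lk \<Otimes>\<^sub>M ?Lp))"
      by (intro measurable_compose[OF _ h] measurable_Pair mat_meas_mult[of _ _ kJ kJ] mat_meas_const Pc) auto
    from refl_Theta[OF this]
    have "(\<integral>\<^sup>+\<omega>. h (Y \<omega>, (P * Theta \<omega>, Sig \<omega>)) \<partial>M)
        = (\<integral>\<^sup>+\<omega>. h (Y \<omega>, (P * (2 \<cdot>\<^sub>m Mn (Y \<omega>) + (-1) \<cdot>\<^sub>m Theta \<omega>), Sig \<omega>)) \<partial>M)"
      by simp
    moreover have "P * (2 \<cdot>\<^sub>m Mn (Y \<omega>) + (-1) \<cdot>\<^sub>m Theta \<omega>) = 2 \<cdot>\<^sub>m (P * Mn (Y \<omega>)) + (-1) \<cdot>\<^sub>m B \<omega>"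
      if \<omega>: "\<omega> \<in> space M" for \<omega>
    proof -
      have m: "Mn (Y \<omega>) \<in> carrier_mat kJ p" and t: "Theta \<omega> \<in> carrier_mat kJ p"
        using measurable_mat_lebesgueD(1)[OF measurable_compose[OF Y Mn_meas] \<omega>]
          measurable_mat_lebesgueD(1)[OF Theta_meas \<omega>] by auto
      show ?thesis
        using m t by (subst mult_add_distrib_mat[OF Pc])
          (auto simp: mult_smult_distrib[OF Pc m] mult_smult_distrib[OF Pc t] PTheta[OF \<omega>])
    qed
    ultimately show ?thesis
      by (simp add: PTheta cong: nn_integral_cong)
  qed
  let ?w = "\<lambda>i. 1 / d i"
  have w: "?w i > 0" if "i < kJ" for i using spec(2)[OF that] by simp
  have fin_Theta: "(\<integral>\<^sup>+\<omega>. ennreal (trace_form (Sig \<omega>) (mat_diag kJ ?w) (Theta \<omega>)) \<partial>M) < \<infinity>"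
    by (rule gaussian_prior_moment_finite[OF M prior_Theta[unfolded Gd] pos g w])
  \<comment> \<open>Both weights are brought to the form R^T diag(1 / d) R, with R the identity here
    and the transpose of P in the next fact.\<close>
  have W_Theta: "mat_inv D = transpose_mat (1\<^sub>m kJ) * mat_diag kJ ?w * 1\<^sub>m kJ"
    unfolding Di by (simp add: left_mult_one_mat[OF mat_diag_dim] right_mult_one_mat[OF mat_diag_dim])
  have W_B: "transpose_mat AJ * AJ = transpose_mat (transpose_mat P) * mat_diag kJ ?w * transpose_mat P"
    using spec(4) by simp
  \<comment> \<open>Since Theta is the transpose of P times B, the loss of estimating B by zero
    coincides pointwise with that of estimating Theta by zero, and the moment bound carries
    over.\<close>
  have fin_B: "(\<integral>\<^sup>+\<omega>. ennreal (trace_form (Sig \<omega>) (transpose_mat AJ * AJ) (B \<omega>)) \<partial>M) < \<infinity>"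
  proof -
    have "trace_form (Sig \<omega>) (transpose_mat AJ * AJ) (B \<omega>) = trace_form (Sig \<omega>) (mat_diag kJ ?w) (Theta \<omega>)"
      if "\<omega> \<in> space M" for \<omega>
      unfolding W_B Theta
      by (rule trace_form_mult[OF measurable_mat_lebesgueD(1)[OF prior_Sig(1) that] Pt mat_diag_dim
          B_car[OF that], symmetric])
    then show ?thesis
      using fin_Theta by (simp cong: nn_integral_cong)
  qed
  \<comment> \<open>Kept generic in the statistic T: it is used with T mapping y to (X_J, S_J) and
    with the identity. The same holds for the version for B below.\<close>
  have est_Theta: "is_the_bayes_estimator M N (\<lambda>\<omega>. T (Y \<omega>)) ?Lk
      (\<lambda>\<omega>. quadratic_loss (mat_inv D) (Sig \<omega>) (Theta \<omega>)) \<Phi>"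
    if "T \<in> ?Ln \<rightarrow>\<^sub>M N" "\<Phi> \<in> N \<rightarrow>\<^sub>M ?Lk" "\<And>y. y \<in> carrier_mat n p \<Longrightarrow> \<Phi> (T y) = Mn y"
    for N :: "'z measure" and T \<Phi>
    by (rule is_the_bayes_estimator_of_reflection[OF finite_measure_axioms Y Theta_meas prior_Sig(1) pos
        Mn_meas refl_Theta one_carrier_mat one_carrier_mat left_mult_one_mat[OF one_carrier_mat]
        w W_Theta fin_Theta[folded Di] that])
  have est_B: "is_the_bayes_estimator M N (\<lambda>\<omega>. T (Y \<omega>)) ?Lk
      (\<lambda>\<omega>. quadratic_loss (transpose_mat AJ * AJ) (Sig \<omega>) (B \<omega>)) \<Phi>"
    if "T \<in> ?Ln \<rightarrow>\<^sub>M N" "\<Phi> \<in> N \<rightarrow>\<^sub>M ?Lk" "\<And>y. y \<in> carrier_mat n p \<Longrightarrow> \<Phi> (T y) = P * Mn y"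
    for N :: "'z measure" and T \<Phi>
    by (rule is_the_bayes_estimator_of_reflection[OF finite_measure_axioms Y B prior_Sig(1) pos
        PMn_meas refl_B Pt Pc spec(1) w W_B fin_B that])
  have BHat_eq: "BHat y = P * ThetaHat (XJ y)" if y: "y \<in> carrier_mat n p" for y
  proof -
    let ?E = "mat_diag kJ e"
    have E: "?E \<in> carrier_mat kJ kJ" by simp
    note PE = mult_carrier_mat[OF Pc E]
    have "BHat y = P * ?E * D * transpose_mat P * transpose_mat AJ * y"
      by (simp add: BHat Ed)
    also have "P * ?E * D * transpose_mat P = P * ?E * (D * transpose_mat P)"
      by (rule assoc_mult_mat[OF PE Dc Pt])
    also have "P * ?E * (D * transpose_mat P) * transpose_mat AJ = P * ?E * (D * transpose_mat P * transpose_mat AJ)"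
      by (rule assoc_mult_mat[OF PE DPt AJt])
    also have "\<dots> * y = P * ?E * (D * transpose_mat P * transpose_mat AJ * y)"
      by (rule assoc_mult_mat[OF PE DPtA y])
    also have "\<dots> = P * (?E * (D * transpose_mat P * transpose_mat AJ * y))"
      by (rule assoc_mult_mat[OF Pc E mult_carrier_mat[OF DPtA y]])
    finally show ?thesis by (simp add: ThetaHat XJ Ed)
  qed
  have BHat_meas: "BHat \<in> ?Ln \<rightarrow>\<^sub>M ?Lk"
    using PMn_meas by (rule measurable_cong[THEN iffD1, rotated]) (simp add: space_mat_lebesgue BHat_eq Mn_def)
  have TH: "(\<lambda>(x, s). ThetaHat x) \<in> ?Lk \<Otimes>\<^sub>M ?Lp \<rightarrow>\<^sub>M ?Lk"
    unfolding case_prod_beta by (rule measurable_compose[OF measurable_fst ThetaHat_meas])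
  have PTH: "(\<lambda>(x, s). P * ThetaHat x) \<in> ?Lk \<Otimes>\<^sub>M ?Lp \<rightarrow>\<^sub>M ?Lk"
    unfolding case_prod_beta
    by (intro mat_meas_mult[of _ _ kJ kJ] mat_meas_const Pc measurable_compose[OF measurable_fst ThetaHat_meas])
  have ident: "(\<lambda>y. y) \<in> ?Ln \<rightarrow>\<^sub>M ?Ln" by simp
  show ?thesis
  proof (intro conjI ballI)
    show "is_generalized_ridge n p kJ AJ P BHat"
      using is_generalized_ridge_of_shrinkage[OF AJ P spec(4,2) e]
      unfolding BHat Ed D(1) by simp
    show "is_the_bayes_estimator M (?Lk \<Otimes>\<^sub>M ?Lp) (\<lambda>\<omega>. (XJ (Y \<omega>), SJ (Y \<omega>))) ?Lk
       (\<lambda>\<omega>. quadratic_loss (mat_inv D) (Sig \<omega>) (Theta \<omega>)) (\<lambda>(x, s). ThetaHat x)"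
      by (rule est_Theta[OF XS_meas TH]) (simp add: Mn_def)
    show "is_the_bayes_estimator M (?Lk \<Otimes>\<^sub>M ?Lp) (\<lambda>\<omega>. (XJ (Y \<omega>), SJ (Y \<omega>))) ?Lk
       (\<lambda>\<omega>. quadratic_loss (transpose_mat AJ * AJ) (Sig \<omega>) (B \<omega>)) (\<lambda>(x, s). P * ThetaHat x)"
      by (rule est_B[OF XS_meas PTH]) (simp add: Mn_def)
    show "is_the_bayes_estimator M ?Ln Y ?Lk
       (\<lambda>\<omega>. quadratic_loss (mat_inv D) (Sig \<omega>) (Theta \<omega>)) (\<lambda>y. ThetaHat (XJ y))"
      by (rule est_Theta[OF ident]) (use Mn_meas in \<open>simp_all add: Mn_def\<close>)
    show "is_the_bayes_estimator M ?Ln Y ?Lk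
       (\<lambda>\<omega>. quadratic_loss (transpose_mat AJ * AJ) (Sig \<omega>) (B \<omega>)) BHat"
      by (rule est_B[OF ident BHat_meas]) (simp add: BHat_eq Mn_def)
  qed (rule BHat_eq)
qed

end
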